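(* Let $(G_1,G_2,k)$ be an instance of 2-Union Independent Set such that $G_1$ and $G_2$ are $c_\forall$-compact. Then a problem kernel with $c_\forall^3$ vertices can be constructed in $O(n\log^2 n)$ time, where $n$ is the number of vertices. The size reduces to $2c_\forall^2$ vertices if one of the input graphs is a proper interval graph.
   Context: 2-Union Independent Set: given two interval graphs $G_1=(V,E_1)$, $G_2=(V,E_2)$ on the same vertex set and a natural number $k$, decide whether $G=(V,E_1\cup E_2)$ has an independent set of size $k$. $n=|V|$. An interval graph is the intersection graph of closed intervals on the real line; it is a proper interval graph if it has a representation in which no interval is properly contained in another. An interval representation is $c$-compact if the start and end points of all intervals lie in $\{1,\dots,c\}$ and the intervals are sorted by increasing start points; an interval graph is $c$-compact if it has a $c$-compact interval representation. $c_\forall$ is the minimum number such that both $G_1$ and $G_2$ are $c_\forall$-compact. Each input graph is assumed to be given by a $c$-compact interval representation for the minimum possible $c$. A problem kernel with $s$ vertices constructed in time $t$ means: an algorithm running in time $t$ produces an equivalent instance $(G_1^*,G_2^*,k^* )$ of 2-Union Independent Set (one is a yes-instance if and only if the other is) whose graphs have at most $s$ vertices and whose parameter is bounded by a function of the original one. *)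

theory Defs
  imports Complex_Main "HOL-Library.Landau_Symbols"
begin

section \<open>Interval graphs and compact representations\<close>

type_synonym vertex = nat
type_synonym edges = "vertex set set"

definition simple_graph :: "vertex set \<Rightarrow> edges \<Rightarrow> bool" where
  "simple_graph V E \<longleftrightarrow> finite V \<and> E \<subseteq> {{u, v} | u v. u \<in> V \<and> v \<in> V \<and> u \<noteq> v}"

definition interval_rep :: "vertex set \<Rightarrow> edges \<Rightarrow> (vertex \<Rightarrow> real) \<Rightarrow> (vertex \<Rightarrow> real) \<Rightarrow> bool" where
  "interval_rep V E l r \<longleftrightarrow>
     (\<forall>v\<in>V. l v \<le> r v) \<and>
     (\<forall>u\<in>V. \<forall>v\<in>V. u \<noteq> v \<longrightarrow> ({u, v} \<in> E \<longleftrightarrow> {l u..r u} \<inter> {l v..r v} \<noteq> {}))"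

definition interval_graph :: "vertex set \<Rightarrow> edges \<Rightarrow> bool" where
  "interval_graph V E \<longleftrightarrow> simple_graph V E \<and> (\<exists>l r. interval_rep V E l r)"

definition proper_interval_graph :: "vertex set \<Rightarrow> edges \<Rightarrow> bool" where
  "proper_interval_graph V E \<longleftrightarrow> simple_graph V E \<and>
     (\<exists>l r. interval_rep V E l r \<and> (\<forall>u\<in>V. \<forall>v\<in>V. \<not> {l u..r u} \<subset> {l v..r v}))"

text \<open>A concrete representation lists every vertex once, as (vertex, start point, end point).\<close>

type_synonym rep_list = "(vertex \<times> nat \<times> nat) list"

definition start_of :: "rep_list \<Rightarrow> vertex \<Rightarrow> nat" where
  "start_of R v = fst (the (map_of R v))"

definition end_of :: "rep_list \<Rightarrow> vertex \<Rightarrow> nat" where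
  "end_of R v = snd (the (map_of R v))"

definition compact_rep :: "nat \<Rightarrow> vertex set \<Rightarrow> edges \<Rightarrow> rep_list \<Rightarrow> bool" where
  "compact_rep c V E R \<longleftrightarrow>
     distinct (map fst R) \<and> fst ` set R = V \<and>
     sorted (map (\<lambda>(v, s, e). s) R) \<and>
     (\<forall>(v, s, e)\<in>set R. s \<in> {1..c} \<and> e \<in> {1..c}) \<and>
     interval_rep V E (\<lambda>v. real (start_of R v)) (\<lambda>v. real (end_of R v))"

definition compact :: "nat \<Rightarrow> vertex set \<Rightarrow> edges \<Rightarrow> bool" where
  "compact c V E \<longleftrightarrow> (\<exists>R. compact_rep c V E R)"

definition c_min :: "vertex set \<Rightarrow> edges \<Rightarrow> nat" where
  "c_min V E = (LEAST c. compact c V E)"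

definition c_all :: "vertex set \<Rightarrow> edges \<Rightarrow> edges \<Rightarrow> nat" where
  "c_all V E1 E2 = (LEAST c. compact c V E1 \<and> compact c V E2)"


section \<open>2-Union Independent Set\<close>

definition independent_set :: "vertex set \<Rightarrow> edges \<Rightarrow> vertex set \<Rightarrow> bool" where
  "independent_set V E S \<longleftrightarrow> S \<subseteq> V \<and> (\<forall>u\<in>S. \<forall>v\<in>S. {u, v} \<notin> E)"

definition union_is_instance :: "vertex set \<Rightarrow> edges \<Rightarrow> edges \<Rightarrow> bool" where
  "union_is_instance V E1 E2 \<longleftrightarrow> interval_graph V E1 \<and> interval_graph V E2"

definition union_is_yes :: "vertex set \<Rightarrow> edges \<Rightarrow> edges \<Rightarrow> nat \<Rightarrow> bool" where
  "union_is_yes V E1 E2 k \<longleftrightarrow> (\<exists>S. independent_set V (E1 \<union> E2) S \<and> card S = k)"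

definition encode_rep :: "rep_list \<Rightarrow> nat list" where
  "encode_rep R = concat (map (\<lambda>(v, s, e). [v, s, e]) R)"

definition encode :: "rep_list \<Rightarrow> rep_list \<Rightarrow> nat \<Rightarrow> nat list" where
  "encode R1 R2 k = k # length R1 # encode_rep R1 @ encode_rep R2"

text \<open>
  The number list \<open>xs\<close> is an encoding of the instance: each graph is given by a compact
  representation with the least possible number of points.
\<close>

definition encodes_instance ::
    "nat list \<Rightarrow> vertex set \<Rightarrow> edges \<Rightarrow> edges \<Rightarrow> nat \<Rightarrow> bool" where
  "encodes_instance xs V E1 E2 k \<longleftrightarrow>
     union_is_instance V E1 E2 \<and>
     (\<exists>R1 R2. compact_rep (c_min V E1) V E1 R1 \<and> compact_rep (c_min V E2) V E2 R2 \<and>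
        xs = encode R1 R2 k)"


section \<open>A word RAM\<close>

text \<open>
  Programs are while programs over numbered registers and an indirectly addressed memory.
  Every operation, memory access, constant and test costs one time unit. All values computed
  (including addresses) must be less than the word bound \<open>W\<close>; a program exceeding it gets stuck.
  Subtraction is truncated, so \<open>y - x \<noteq> 0\<close> serves as the test \<open>x < y\<close>; division by \<open>0\<close> yields \<open>0\<close>.
\<close>

datatype rexp =
    Const nat
  | Reg nat
  | Mem rexp
  | Add rexp rexp
  | Sub rexp rexp
  | Mul rexp rexp
  | Div rexp rexp

datatype com =
    Skip
  | Assign nat rexp
  | Store rexp rexp
  | Seq com com
  | IfNZ rexp com com
  | WhileNZ rexp com

type_synonym state = "(nat \<Rightarrow> nat) \<times> (nat \<Rightarrow> nat)"

fun rval :: "state \<Rightarrow> rexp \<Rightarrow> nat" where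
  "rval s (Const a) = a"
| "rval s (Reg i) = fst s i"
| "rval s (Mem e) = snd s (rval s e)"
| "rval s (Add e f) = rval s e + rval s f"
| "rval s (Sub e f) = rval s e - rval s f"
| "rval s (Mul e f) = rval s e * rval s f"
| "rval s (Div e f) = rval s e div rval s f"

fun subexps :: "rexp \<Rightarrow> rexp list" where
  "subexps (Const a) = [Const a]"
| "subexps (Reg i) = [Reg i]"
| "subexps (Mem e) = Mem e # subexps e"
| "subexps (Add e f) = Add e f # subexps e @ subexps f"
| "subexps (Sub e f) = Sub e f # subexps e @ subexps f"
| "subexps (Mul e f) = Mul e f # subexps e @ subexps f"
| "subexps (Div e f) = Div e f # subexps e @ subexps f"

definition rcost :: "rexp \<Rightarrow> nat" where
  "rcost e = length (subexps e)"

definition fits :: "nat \<Rightarrow> state \<Rightarrow> rexp \<Rightarrow> bool" where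
  "fits W s e \<longleftrightarrow> (\<forall>f\<in>set (subexps e). rval s f < W)"

text \<open>\<open>exec W p s t s'\<close>: with word bound \<open>W\<close>, program \<open>p\<close> halts from \<open>s\<close> in \<open>s'\<close> after \<open>t\<close> time units.\<close>

inductive exec :: "nat \<Rightarrow> com \<Rightarrow> state \<Rightarrow> nat \<Rightarrow> state \<Rightarrow> bool" for W :: nat where
  Skip: "exec W Skip s 1 s"
| Assign: "fits W s e \<Longrightarrow>
    exec W (Assign i e) s (1 + rcost e) ((fst s)(i := rval s e), snd s)"
| Store: "fits W s a \<Longrightarrow> fits W s e \<Longrightarrow>
    exec W (Store a e) s (1 + rcost a + rcost e) (fst s, (snd s)(rval s a := rval s e))"
| Seq: "exec W p s t s' \<Longrightarrow> exec W q s' t' s'' \<Longrightarrow> exec W (Seq p q) s (t + t') s''"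
| IfTrue: "fits W s e \<Longrightarrow> rval s e \<noteq> 0 \<Longrightarrow> exec W p s t s' \<Longrightarrow>
    exec W (IfNZ e p q) s (1 + rcost e + t) s'"
| IfFalse: "fits W s e \<Longrightarrow> rval s e = 0 \<Longrightarrow> exec W q s t s' \<Longrightarrow>
    exec W (IfNZ e p q) s (1 + rcost e + t) s'"
| WhileTrue: "fits W s e \<Longrightarrow> rval s e \<noteq> 0 \<Longrightarrow> exec W p s t s' \<Longrightarrow>
    exec W (WhileNZ e p) s' t' s'' \<Longrightarrow> exec W (WhileNZ e p) s (1 + rcost e + t + t') s''"
| WhileFalse: "fits W s e \<Longrightarrow> rval s e = 0 \<Longrightarrow> exec W (WhileNZ e p) s (1 + rcost e) s"

lemma exec_deterministic:
  "exec W p s t s' \<Longrightarrow> exec W p s u s'' \<Longrightarrow> t = u \<and> s' = s''"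
proof (induction arbitrary: u s'' rule: exec.induct)
  case (Skip s)
  from Skip.prems show ?case by cases simp
next
  case (Assign s e i)
  from Assign.prems show ?case by cases simp
next
  case (Store s a e)
  from Store.prems show ?case by cases simp
next
  case (Seq p s t s' q t' s2)
  from Seq.prems show ?case
  proof cases
    case (Seq t1 s1 t2)
    then show ?thesis using Seq.IH(1)[of t1 s1] Seq.IH(2)[of t2 s''] by simp
  qed
next
  case (IfTrue s e p t s' q)
  from IfTrue.prems show ?case
  proof cases
    case (IfTrue t1)
    then show ?thesis using IfTrue.IH[of t1 s''] by simp
  qed (use IfTrue.hyps(2) in simp)
next
  case (IfFalse s e q t s' p)
  from IfFalse.prems show ?case
  proof cases
    case (IfFalse t1)
    then show ?thesis using IfFalse.IH[of t1 s''] by simp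
  qed (use IfFalse.hyps(2) in simp)
next
  case (WhileTrue s e p t s' t' s2)
  from WhileTrue.prems show ?case
  proof cases
    case (WhileTrue t1 s1 t2)
    then show ?thesis using WhileTrue.IH(1)[of t1 s1] WhileTrue.IH(2)[of t2 s''] by simp
  qed (use WhileTrue.hyps(2) in simp)
next
  case (WhileFalse s e p)
  from WhileFalse.prems show ?case by cases (use WhileFalse.hyps in simp_all)
qed

text \<open>
  The input is placed in memory cells \<open>0, 1, \<dots>\<close> with its length in register \<open>0\<close>; everything else
  is zero. The output is read off in the same way.
\<close>

definition initial_state :: "nat list \<Rightarrow> state" where
  "initial_state xs =
     ((\<lambda>i. if i = 0 then length xs else 0), (\<lambda>a. if a < length xs then xs ! a else 0))"

definition output_of :: "state \<Rightarrow> nat list" where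
  "output_of s = map (snd s) [0..<fst s 0]"

text \<open>
  The word bound is a fixed power \<open>d\<close> of the length of the input plus its largest entry, i.e. a
  word has \<open>O(log m)\<close> bits for inputs with at most \<open>m\<close> entries, each at most \<open>m\<close>.
\<close>

definition word_bound :: "nat \<Rightarrow> nat list \<Rightarrow> nat" where
  "word_bound d xs = (2 + length xs + Max (insert 0 (set xs))) ^ d"

definition computes :: "com \<Rightarrow> nat \<Rightarrow> nat list \<Rightarrow> nat \<Rightarrow> nat list \<Rightarrow> bool" where
  "computes p d xs t ys \<longleftrightarrow>
     (\<exists>s. exec (word_bound d xs) p (initial_state xs) t s \<and> output_of s = ys)"

end

theory Submission
  imports Defs
begin

text \<open>
  A vertex is redundant if another one has smaller intervals in both graphs: in every independent set
  the former can be exchanged for the latter. Hence, for each triple consisting of the interval in one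
  graph and the end point in the other, only the vertex with the last start point in the other graph
  needs to be kept. As the input is sorted by start points, this is the last vertex with this triple,
  and one pass over each representation with a directly addressed table suffices. At most
  \<open>c\<^sup>3\<close> triples of points remain. In a minimal representation of a proper interval graph no interval lies
  strictly inside another one, so that an interval is determined by the sum of its end points, and there
  are at most \<open>2 * c\<close> intervals and \<open>2 * c\<^sup>2\<close> triples. Finally, sweeping over the points and merging those
  between which no interval ends before another one starts makes the restricted representations minimal
  again. The whole computation takes linear time.
\<close>

section \<open>Total correctness with time bounds on the word RAM\<close>

text \<open>Two rounds with exchanged roles are needed because it is not known which graph is
  proper: the bound \<open>2 * c\<^sup>2\<close> requires triples containing the whole interval of
  the proper graph. The second round admits only survivors of the first, so both kinds of triples
  are distinct on the final vertex set, while domination composes. The obstacle on the machine is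
  the word bound, a power of a number \<open>m\<close> slightly above the input length plus the
  largest entry. Triples are coded by numbers up to the cube of the input length, which may exceed
  \<open>m\<close>. They are therefore never stored and occur only inside address expressions. All
  stored values stay below \<open>m\<close>, and an exponent read off the program text bounds the
  intermediate values. In a minimal representation every point is both a start and an end point.
  Hence there are at most \<open>n\<close> points, which makes the coding of triples injective and
  the sweep linear; and for every interval there is one ending at its start and one starting at its
  end, from which the claw is built.\<close>

definition below :: "nat \<Rightarrow> state \<Rightarrow> bool" where
  "below m s \<longleftrightarrow> 2 \<le> m \<and> (\<forall>i. fst s i < m) \<and> (\<forall>a. snd s a < m)"

text \<open>An exponent for which \<open>m ^ expr_degree e\<close> exceeds the value of
  \<open>e\<close> and of its subexpressions. A constant counts with its own value since
  \<open>a < 2 ^ a \<le> m ^ a\<close>; a sum pays one more since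
  \<open>x + y \<le> 2 * x * y\<close> for positive bounds. Only independence of the input matters,
  so crude sums serve.\<close>

fun expr_degree :: "rexp \<Rightarrow> nat" where
  "expr_degree (Const a) = a"
| "expr_degree (Reg i) = 1"
| "expr_degree (Mem e) = 1 + expr_degree e"
| "expr_degree (Add e f) = 1 + expr_degree e + expr_degree f"
| "expr_degree (Sub e f) = expr_degree e + expr_degree f"
| "expr_degree (Mul e f) = expr_degree e + expr_degree f"
| "expr_degree (Div e f) = expr_degree e + expr_degree f"

fun com_degree :: "com \<Rightarrow> nat" where
  "com_degree Skip = 0"
| "com_degree (Assign i e) = expr_degree e"
| "com_degree (Store a e) = expr_degree a + expr_degree e"
| "com_degree (Seq p q) = com_degree p + com_degree q"
| "com_degree (IfNZ e p q) = expr_degree e + com_degree p + com_degree q"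
| "com_degree (WhileNZ e p) = expr_degree e + com_degree p"

lemma expr_degree_subexps: "f \<in> set (subexps e) \<Longrightarrow> expr_degree f \<le> expr_degree e"
  by (induction e) auto

lemma rval_less:
  assumes "below m s"
  shows "rval s e < m ^ expr_degree e"
proof (induction e)
  case (Const a)
  have "a < 2 ^ a" by (rule less_exp)
  also have "\<dots> \<le> m ^ a" using assms by (intro power_mono) (auto simp: below_def)
  finally show ?case by simp
next
  case (Mem e)
  have "rval s (Mem e) < m ^ 1" using assms by (simp add: below_def)
  also have "m ^ 1 \<le> m ^ expr_degree (Mem e)" using assms by (intro power_increasing) (auto simp: below_def)
  finally show ?case .
next
  case (Add e f)
  let ?a = "m ^ expr_degree e" and ?b = "m ^ expr_degree f"
  have "rval s e + rval s f + 1 \<le> ?a + ?b" using Add by simp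
  also have "\<dots> \<le> 2 * (?a * ?b)"
  proof -
    have "0 < ?a" "0 < ?b" using Add by linarith+
    then have "?a * 1 \<le> ?a * ?b" "1 * ?b \<le> ?a * ?b"
      unfolding mult_le_cancel1 mult_le_cancel2 by linarith+
    then show ?thesis by linarith
  qed
  also have "\<dots> \<le> m * (?a * ?b)" using assms by (intro mult_right_mono) (auto simp: below_def)
  finally show ?case by (simp add: power_add)
next
  case (Sub e f)
  have "rval s e - rval s f < m ^ expr_degree e * 1" using Sub by simp
  also have "\<dots> \<le> m ^ expr_degree e * m ^ expr_degree f" using Sub by (intro mult_le_mono2) simp
  finally show ?case by (simp add: power_add)
next
  case (Mul e f)
  then show ?case by (simp add: power_add mult_strict_mono')
next
  case (Div e f)
  have "rval s e div rval s f < m ^ expr_degree e * 1" using le_less_trans[OF div_le_dividend Div(1)] by simp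
  also have "\<dots> \<le> m ^ expr_degree e * m ^ expr_degree f" using Div by (intro mult_le_mono2) simp
  finally show ?case by (simp add: power_add)
qed (use assms in \<open>auto simp: below_def\<close>)

lemma fits_if_below:
  assumes "below m s" "expr_degree e \<le> d"
  shows "fits (m ^ d) s e"
  unfolding fits_def
proof
  fix f assume "f \<in> set (subexps e)"
  then have "expr_degree f \<le> d" using expr_degree_subexps assms(2) by (meson le_trans)
  then have "m ^ expr_degree f \<le> m ^ d" using assms(1) by (intro power_increasing) (auto simp: below_def)
  then show "rval s f < m ^ d" using rval_less[OF assms(1), of f] by simp
qed

text \<open>
  One unit of \<open>time_coeff\<close> is charged per round of a loop: a program without nested loops, each of which
  makes at most \<open>n\<close> rounds, takes at most \<open>time_coeff p * (n + 1)\<close> steps.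
\<close>

fun time_coeff :: "com \<Rightarrow> nat" where
  "time_coeff Skip = 1"
| "time_coeff (Assign i e) = 1 + rcost e"
| "time_coeff (Store a e) = 1 + rcost a + rcost e"
| "time_coeff (Seq p q) = time_coeff p + time_coeff q"
| "time_coeff (IfNZ e p q) = 1 + rcost e + time_coeff p + time_coeff q"
| "time_coeff (WhileNZ e p) = 1 + rcost e + time_coeff p"

text \<open>Only loop-free commands are covered; all loops have the form \<open>For\<close> and get
  their own rule. Intermediate values need no side condition, as \<open>fits_if_below\<close>
  settles them from the syntax: only stored values are compared with \<open>m\<close>.\<close>

fun wp :: "nat \<Rightarrow> com \<Rightarrow> (state \<Rightarrow> bool) \<Rightarrow> state \<Rightarrow> bool" where
  "wp m Skip Q s = Q s"
| "wp m (Assign i e) Q s = (rval s e < m \<and> Q ((fst s)(i := rval s e), snd s))"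
| "wp m (Store a e) Q s = (rval s e < m \<and> Q (fst s, (snd s)(rval s a := rval s e)))"
| "wp m (Seq p q) Q s = wp m p (wp m q Q) s"
| "wp m (IfNZ e p q) Q s = (if rval s e \<noteq> 0 then wp m p Q s else wp m q Q s)"
| "wp m (WhileNZ e p) Q s = False"

lemma wp_exec:
  assumes "wp m p Q s" "below m s" "com_degree p \<le> d"
  shows "\<exists>t s'. exec (m ^ d) p s t s' \<and> t \<le> time_coeff p \<and> below m s' \<and> Q s'"
  using assms
proof (induction p arbitrary: Q s)
  case Skip
  show ?case by (intro exI conjI, rule exec.Skip) (use Skip in simp_all)
next
  case (Assign i e)
  then have f: "fits (m ^ d) s e" by (auto intro: fits_if_below)
  have b: "below m ((fst s)(i := rval s e), snd s)" using Assign by (auto simp: below_def)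
  show ?case
    by (intro exI conjI, rule exec.Assign) (use Assign.prems(1) f b in simp_all)
next
  case (Store a e)
  then have f: "fits (m ^ d) s a" "fits (m ^ d) s e" by (auto intro: fits_if_below)
  have b: "below m (fst s, (snd s)(rval s a := rval s e))" using Store by (auto simp: below_def)
  show ?case
    by (intro exI conjI, rule exec.Store) (use Store.prems(1) f b in simp_all)
next
  case (Seq p q)
  then have d: "com_degree p \<le> d" "com_degree q \<le> d" by auto
  obtain t s' where 1: "exec (m ^ d) p s t s'" "t \<le> time_coeff p" "below m s'" "wp m q Q s'"
    using Seq.IH(1)[OF _ Seq.prems(2) d(1)] Seq.prems(1) unfolding wp.simps by blast
  obtain t' s'' where 2: "exec (m ^ d) q s' t' s''" "t' \<le> time_coeff q" "below m s''" "Q s''"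
    using Seq.IH(2)[OF 1(4,3) d(2)] by blast
  show ?case
    by (intro exI conjI, rule exec.Seq[OF 1(1) 2(1)]) (use 1 2 in simp_all)
next
  case (IfNZ e p q)
  have f: "fits (m ^ d) s e" using IfNZ.prems by (auto intro: fits_if_below)
  have d: "com_degree p \<le> d" "com_degree q \<le> d" using IfNZ.prems by auto
  show ?case
  proof (cases "rval s e = 0")
    case True
    then obtain t s' where 1: "exec (m ^ d) q s t s'" "t \<le> time_coeff q" "below m s'" "Q s'"
      using IfNZ.IH(2)[OF _ IfNZ.prems(2) d(2)] IfNZ.prems(1) by fastforce
    show ?thesis
      by (intro exI conjI, rule exec.IfFalse[OF f True 1(1)]) (use 1 in simp_all)
  next
    case False
    then obtain t s' where 1: "exec (m ^ d) p s t s'" "t \<le> time_coeff p" "below m s'" "Q s'"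
      using IfNZ.IH(1)[OF _ IfNZ.prems(2) d(1)] IfNZ.prems(1) by fastforce
    show ?thesis
      by (intro exI conjI, rule exec.IfTrue[OF f False 1(1)]) (use 1 in simp_all)
  qed
qed simp

text \<open>\<open>n\<close> bounds the number of rounds of each loop. The exponent \<open>d\<close>
  is left open above \<open>com_degree p\<close>, so that a part of a program can be run with the
  exponent of the whole.\<close>

definition runs :: "nat \<Rightarrow> nat \<Rightarrow> com \<Rightarrow> state \<Rightarrow> (state \<Rightarrow> bool) \<Rightarrow> bool" where
  "runs m n p s Q \<longleftrightarrow> below m s \<longrightarrow> (\<forall>d\<ge>com_degree p.
     \<exists>t s'. exec (m ^ d) p s t s' \<and> t \<le> time_coeff p * (n + 1) \<and> below m s' \<and> Q s')"

lemma runs_wp: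
  assumes "wp m p Q s"
  shows "runs m n p s Q"
proof -
  have "time_coeff p \<le> time_coeff p * (n + 1)" by simp
  then show ?thesis unfolding runs_def using wp_exec[OF assms] le_trans by blast
qed

lemma runs_Seq:
  assumes "runs m n p s (\<lambda>s'. runs m n q s' Q)"
  shows "runs m n (Seq p q) s Q"
  unfolding runs_def
proof (intro impI allI)
  fix d assume b: "below m s" and d: "com_degree (Seq p q) \<le> d"
  then obtain t s' where 1: "exec (m ^ d) p s t s'" "t \<le> time_coeff p * (n + 1)" "below m s'"
    "runs m n q s' Q"
    using assms[unfolded runs_def[of m n p], rule_format, OF b, of d] by auto
  then obtain t' s'' where 2: "exec (m ^ d) q s' t' s''" "t' \<le> time_coeff q * (n + 1)" "below m s''" "Q s''"
    using 1(4)[unfolded runs_def, rule_format, OF 1(3), of d] d by auto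
  have "t + t' \<le> time_coeff (Seq p q) * (n + 1)" using 1 2 by (simp add: algebra_simps)
  then show "\<exists>t s'. exec (m ^ d) (Seq p q) s t s' \<and> t \<le> time_coeff (Seq p q) * (n + 1) \<and> below m s' \<and> Q s'"
    using exec.Seq[OF 1(1) 2(1)] 2 by blast
qed

lemma runs_conseq:
  assumes "runs m n p s Q" "\<And>s'. Q s' \<Longrightarrow> Q' s'"
  shows "runs m n p s Q'"
  using assms unfolding runs_def by blast

lemmas runs_SeqI = runs_Seq[OF runs_conseq]

lemma wp_conseq:
  assumes "wp m p Q s" "\<And>s'. Q s' \<Longrightarrow> Q' s'"
  shows "wp m p Q' s"
  using assms by (induction p arbitrary: Q Q' s) (auto split: if_splits)

section \<open>Counting loops\<close>

definition For :: "com \<Rightarrow> com" where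
  "For p = Seq (Assign 2 (Const 0)) (WhileNZ (Sub (Reg 1) (Reg 2))
     (Seq p (Assign 2 (Add (Reg 2) (Const 1)))))"

text \<open>Induction on the number of remaining rounds. The additional unit in
  \<open>n - i + 1\<close> pays for the final failing test.\<close>

lemma exec_While_For:
  fixes I :: "nat \<Rightarrow> state \<Rightarrow> bool" and p m
  defines "b \<equiv> Seq p (Assign 2 (Add (Reg 2) (Const 1)))"
  defines "w \<equiv> WhileNZ (Sub (Reg 1) (Reg 2)) b"
  assumes d: "com_degree w \<le> d"
  assumes step: "\<And>i s. i < n \<Longrightarrow> fst s 1 = n \<Longrightarrow> fst s 2 = i \<Longrightarrow> I i s \<Longrightarrow> wp m b (\<lambda>s'. fst s' 1 = n \<and> fst s' 2 = Suc i \<and> I (Suc i) s') s"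
  assumes "i \<le> n" "below m s" "fst s 1 = n" "fst s 2 = i" "I i s"
  shows "\<exists>t s'. exec (m ^ d) w s t s' \<and> t \<le> time_coeff w * (n - i + 1) \<and> below m s' \<and> fst s' 1 = n \<and> I n s'"
  using assms(5-)
proof (induction "n - i" arbitrary: i s)
  case 0
  then have "exec (m ^ d) w s (1 + rcost (Sub (Reg 1) (Reg 2))) s"
    using d unfolding w_def by (intro exec.WhileFalse fits_if_below) auto
  moreover have "1 + rcost (Sub (Reg 1) (Reg 2)) \<le> time_coeff w * (n - i + 1)" by (simp add: w_def)
  ultimately show ?case using 0 by (metis diff_is_0_eq le_antisym)
next
  case (Suc x)
  let ?e = "Sub (Reg 1) (Reg 2)"
  have i: "i < n" using Suc by simp
  obtain t s' where 1: "exec (m ^ d) b s t s'" "t \<le> time_coeff b" "below m s'"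
    "fst s' 1 = n" "fst s' 2 = Suc i" "I (Suc i) s'"
    using wp_exec[OF step[OF i Suc.prems(3,4,5)] Suc.prems(2), of d] d unfolding w_def by auto
  have x: "x = n - Suc i" using \<open>Suc x = n - i\<close> by simp
  have "\<exists>t s''. exec (m ^ d) w s' t s'' \<and> t \<le> time_coeff w * (n - Suc i + 1) \<and> below m s'' \<and>
      fst s'' 1 = n \<and> I n s''"
    by (rule Suc.hyps(1)[OF x Suc_leI[OF i] 1(3-6)])
  then obtain t' s'' where 2: "exec (m ^ d) w s' t' s''" "t' \<le> time_coeff w * (n - Suc i + 1)" "below m s''"
    "fst s'' 1 = n" "I n s''"
    by blast
  have "exec (m ^ d) w s (1 + rcost ?e + t + t') s''"
    unfolding w_def
  proof (rule exec.WhileTrue)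
    show "fits (m ^ d) s ?e" using d Suc unfolding w_def by (intro fits_if_below) auto
    show "rval s ?e \<noteq> 0" using Suc i by simp
  qed (use 1(1) 2(1) in \<open>auto simp: w_def\<close>)
  moreover have "1 + rcost ?e + t + t' \<le> time_coeff w * (n - i + 1)"
  proof -
    have "1 + rcost ?e + t \<le> time_coeff w" using 1 by (simp add: w_def)
    then have "1 + rcost ?e + t + t' \<le> time_coeff w * 1 + time_coeff w * (n - Suc i + 1)"
      using 2 by (intro add_mono) auto
    also have "\<dots> = time_coeff w * (n - i + 1)" using i by (simp only: distrib_left[symmetric]) (simp add: Suc_diff_Suc)
    finally show ?thesis .
  qed
  ultimately show ?case using 2 by blast
qed

text \<open>Registers \<open>6\<close> and \<open>7\<close> are the only ones that carry data from
  one round to the next, so the invariant sees just them and the memory. The counter reaches the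
  value \<open>n\<close>, whence \<open>n < m\<close>.\<close>

lemma runs_For:
  fixes I :: "nat \<Rightarrow> (nat \<Rightarrow> nat) \<Rightarrow> nat \<Rightarrow> nat \<Rightarrow> bool"
  assumes s: "n < m" "fst s 0 = L" "fst s 1 = n" "I 0 (snd s) (fst s 6) (fst s 7)"
  assumes step: "\<And>i r mem. i < n \<Longrightarrow> r 0 = L \<Longrightarrow> r 1 = n \<Longrightarrow> r 2 = i \<Longrightarrow> I i mem (r 6) (r 7) \<Longrightarrow>
    wp m p (\<lambda>s'. fst s' 0 = L \<and> fst s' 1 = n \<and> fst s' 2 = i \<and>
      I (Suc i) (snd s') (fst s' 6) (fst s' 7)) (r, mem)"
  shows "runs m n (For p) s (\<lambda>s'. fst s' 0 = L \<and> fst s' 1 = n \<and> I n (snd s') (fst s' 6) (fst s' 7))"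
  unfolding For_def
proof (intro runs_Seq[OF runs_conseq[OF runs_wp]])
  let ?w = "WhileNZ (Sub (Reg 1) (Reg 2)) (Seq p (Assign 2 (Add (Reg 2) (Const 1))))"
  let ?J = "\<lambda>i s. fst s 0 = L \<and> I i (snd s) (fst s 6) (fst s 7)"
  let ?Q = "\<lambda>s'. fst s' 0 = L \<and> fst s' 1 = n \<and> I n (snd s') (fst s' 6) (fst s' 7)"
  let ?P = "\<lambda>s. fst s 1 = n \<and> fst s 2 = 0 \<and> ?J 0 s"
  show "wp m (Assign 2 (Const 0)) ?P s"
    using s by simp
  have body: "wp m (Seq p (Assign 2 (Add (Reg 2) (Const 1))))
      (\<lambda>s'. fst s' 1 = n \<and> fst s' 2 = Suc i \<and> ?J (Suc i) s') s"
    if "i < n" "fst s 1 = n" "fst s 2 = i" "?J i s" for i s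
  proof -
    have "wp m p (\<lambda>s'. fst s' 0 = L \<and> fst s' 1 = n \<and> fst s' 2 = i \<and>
        I (Suc i) (snd s') (fst s' 6) (fst s' 7)) (fst s, snd s)"
      using that by (intro step) simp_all
    then show ?thesis
      unfolding wp.simps(4) prod.collapse by (rule wp_conseq) (use that(1) s(1) in simp)
  qed
  show "runs m n ?w s' ?Q" if "?P s'" for s'
    unfolding runs_def
  proof (intro impI allI)
    fix d assume "below m s'" "com_degree ?w \<le> d"
    note b = this
    have "\<exists>t s''. exec (m ^ d) ?w s' t s'' \<and> t \<le> time_coeff ?w * (n - 0 + 1) \<and> below m s'' \<and>
        fst s'' 1 = n \<and> ?J n s''"
      by (rule exec_While_For[OF b(2) body _ b(1)]) (use that in simp_all)
    then show "\<exists>t s''. exec (m ^ d) ?w s' t s'' \<and> t \<le> time_coeff ?w * (n + 1) \<and> below m s'' \<and> ?Q s''"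
      unfolding diff_zero by blast
  qed
qed

section \<open>Minimal compact representations\<close>

text \<open>
  A sweep over the points \<open>1, 2, \<dots>\<close> opens a new block at each start point that comes after an end
  point of the current block. The sweep state is the number of blocks opened so far and whether the
  next start point opens a new one.
\<close>

fun sweep :: "(nat \<Rightarrow> bool) \<Rightarrow> (nat \<Rightarrow> bool) \<Rightarrow> nat \<Rightarrow> nat \<times> bool" where
  "sweep st en 0 = (0, True)"
| "sweep st en (Suc p) = (let (b, fr) = sweep st en p in
     (if st (Suc p) \<and> fr then Suc b else b, en (Suc p) \<or> (fr \<and> \<not> st (Suc p))))"

definition block :: "(nat \<Rightarrow> bool) \<Rightarrow> (nat \<Rightarrow> bool) \<Rightarrow> nat \<Rightarrow> nat" where
  "block st en p = fst (sweep st en p)"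

definition fresh :: "(nat \<Rightarrow> bool) \<Rightarrow> (nat \<Rightarrow> bool) \<Rightarrow> nat \<Rightarrow> bool" where
  "fresh st en p = snd (sweep st en p)"

lemma block_simps [simp]:
  "block st en 0 = 0" "fresh st en 0"
  "block st en (Suc p) = (if st (Suc p) \<and> fresh st en p then Suc (block st en p) else block st en p)"
  "fresh st en (Suc p) \<longleftrightarrow> en (Suc p) \<or> (fresh st en p \<and> \<not> st (Suc p))"
  by (auto simp: block_def fresh_def split: prod.splits)

lemma block_mono: "p \<le> q \<Longrightarrow> block st en p \<le> block st en q"
  by (induction q rule: dec_induct) auto

text \<open>A point opens at most one block. With \<open>p = 0\<close>, blocks never outnumber
  points; with later \<open>p\<close>, a sweep that reaches the maximal number of blocks has no
  slack anywhere.\<close>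

lemma block_add: "block st en (p + j) \<le> block st en p + j"
  by (induction j) auto

text \<open>Freshness persists until the next start point, which opens a block. Hence an interval
  starting after the end of another one stays separated from it after renumbering.\<close>

lemma block_less_if_fresh:
  assumes "fresh st en p" "p < q" "st q"
  shows "block st en p < block st en q"
proof -
  have *: "fresh st en (p + j) \<or> block st en p < block st en (p + j)" for j
    using assms(1) by (induction j) (auto simp: less_Suc_eq_le intro: block_mono)
  obtain j where "q = Suc (p + j)" using assms(2) less_iff_Suc_add by auto
  then show ?thesis using *[of j] assms(3) block_mono[of p "p + j" st en] by auto
qed

lemma fresh_end: "en p \<Longrightarrow> fresh st en p"
  by (cases p) auto

lemma block_start: "1 \<le> q \<Longrightarrow> q \<le> block st en N \<Longrightarrow> \<exists>p\<in>{1..N}. st p \<and> block st en p = q"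
proof (induction N)
  case (Suc N)
  show ?case
  proof (cases "q \<le> block st en N")
    case True
    then show ?thesis using Suc by fastforce
  next
    case False
    then have "st (Suc N) \<and> q = block st en (Suc N)" using Suc by (auto split: if_splits)
    then show ?thesis by (intro bexI[of _ "Suc N"]) auto
  qed
qed simp

text \<open>A block is left only after an end point in it made the state fresh; the second disjunct
  is the last block once this has happened. \<open>1 \<le> q\<close> rules out the initial
  freshness, which stems from no end point.\<close>

lemma block_end_aux:
  "1 \<le> q \<Longrightarrow> q < block st en N \<or> q = block st en N \<and> fresh st en N \<Longrightarrow>
    \<exists>p\<in>{1..N}. en p \<and> block st en p = q"
proof (induction N)
  case (Suc N)
  show ?case
  proof (cases "q < block st en N \<or> q = block st en N \<and> fresh st en N")
    case True
    then show ?thesis using Suc by fastforce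
  next
    case False
    then have "en (Suc N) \<and> q = block st en (Suc N)" using Suc by (auto split: if_splits)
    then show ?thesis by (intro bexI[of _ "Suc N"]) auto
  qed
qed simp

text \<open>No further start closes the last block. There, an interval starting in it supplies the
  end point, as no later block exists.\<close>

lemma block_end:
  assumes "1 \<le> q" "q \<le> block st en N" "\<And>p. p \<in> {1..N} \<Longrightarrow> st p \<Longrightarrow> \<exists>e\<in>{p..N}. en e"
  shows "\<exists>p\<in>{1..N}. en p \<and> block st en p = q"
proof (cases "q < block st en N")
  case True
  then show ?thesis using block_end_aux assms by blast
next
  case False
  then have q: "q = block st en N" using assms by simp
  obtain p where p: "p \<in> {1..N}" "st p" "block st en p = q" using block_start assms by metis
  then obtain e where e: "e \<in> {p..N}" "en e" using assms(3) by blast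
  then have "block st en e = q"
    using p q block_mono[of p e st en] block_mono[of e N st en] by auto
  then show ?thesis using e p by (intro bexI[of _ e]) auto
qed

section \<open>Adjacency in terms of start and end points\<close>

lemma interval_meet:
  fixes a b c d :: real
  assumes "a \<le> b" "c \<le> d"
  shows "{a..b} \<inter> {c..d} \<noteq> {} \<longleftrightarrow> a \<le> d \<and> c \<le> b"
  using assms by auto

lemma interval_repD:
  assumes "interval_rep V E (\<lambda>v. real (l v)) (\<lambda>v. real (r v))" "u \<in> V" "v \<in> V"
  shows "l u \<le> r u" "u \<noteq> v \<Longrightarrow> {u, v} \<in> E \<longleftrightarrow> l u \<le> r v \<and> l v \<le> r u"
  using assms interval_meet[of "real (l u)" "real (r u)" "real (l v)" "real (r v)"]
  unfolding interval_rep_def by auto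

lemma interval_repI:
  assumes "\<And>u. u \<in> V \<Longrightarrow> l u \<le> r u"
    "\<And>u v. u \<in> V \<Longrightarrow> v \<in> V \<Longrightarrow> u \<noteq> v \<Longrightarrow> {u, v} \<in> E \<longleftrightarrow> l u \<le> r v \<and> l v \<le> r u"
  shows "interval_rep V E (\<lambda>v. real (l v)) (\<lambda>v. real (r v))"
  unfolding interval_rep_def
proof (intro conjI ballI impI)
  fix u v assume "u \<in> V" "v \<in> V" "u \<noteq> v"
  then show "{u, v} \<in> E \<longleftrightarrow> {real (l u)..real (r u)} \<inter> {real (l v)..real (r v)} \<noteq> {}"
    using assms interval_meet[of "real (l u)" "real (r u)" "real (l v)" "real (r v)"] by auto
qed (use assms in auto)

lemma compact_rep_mem:
  assumes "distinct (map fst R)" "(v, s, e) \<in> set R"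
  shows "start_of R v = s" "end_of R v = e"
  using assms by (auto simp: start_of_def end_of_def)

lemma compact_rep_entry:
  assumes "compact_rep c V E R" "v \<in> V"
  shows "(v, start_of R v, end_of R v) \<in> set R"
proof -
  obtain s e where "(v, s, e) \<in> set R" using assms unfolding compact_rep_def by force
  then show ?thesis using compact_rep_mem assms unfolding compact_rep_def by metis
qed

lemma compact_repD:
  assumes "compact_rep c V E R" "v \<in> V"
  shows "1 \<le> start_of R v" "start_of R v \<le> end_of R v" "end_of R v \<le> c"
proof -
  have "l v \<le> r v" if "interval_rep V E l r" for l r :: "nat \<Rightarrow> real"
    using that assms(2) unfolding interval_rep_def by auto
  then show "start_of R v \<le> end_of R v"
    using assms(1) unfolding compact_rep_def by fastforce
qed (use compact_rep_entry[OF assms] assms(1) in \<open>auto simp: compact_rep_def\<close>)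

lemma compact_mono: "compact_rep c V E R \<Longrightarrow> c \<le> c' \<Longrightarrow> compact_rep c' V E R"
  unfolding compact_rep_def by fastforce

text \<open>
  If every point is both a start and an end point, then an interval ending at \<open>p\<close> and one starting at
  \<open>p\<close> meet in every representation. The common points chosen for different \<open>p\<close> are different.
\<close>

lemma points_le_if_tight:
  assumes R: "compact_rep c V E R" and R': "compact_rep c' V E R'"
    and st: "\<And>p. p \<in> {1..c} \<Longrightarrow> \<exists>v\<in>V. start_of R v = p"
    and en: "\<And>p. p \<in> {1..c} \<Longrightarrow> \<exists>v\<in>V. end_of R v = p"
  shows "c \<le> c'"
proof -
  obtain a where a: "\<And>p. p \<in> {1..c} \<Longrightarrow> a p \<in> V \<and> end_of R (a p) = p" using en by metis
  obtain b where b: "\<And>p. p \<in> {1..c} \<Longrightarrow> b p \<in> V \<and> start_of R (b p) = p" using st by metis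
  note D = interval_repD[where l = "start_of R" and r = "end_of R" and V = V and E = E]
  note D' = interval_repD[where l = "start_of R'" and r = "end_of R'" and V = V and E = E]
  have i: "interval_rep V E (\<lambda>v. real (start_of R v)) (\<lambda>v. real (end_of R v))"
    "interval_rep V E (\<lambda>v. real (start_of R' v)) (\<lambda>v. real (end_of R' v))"
    using R R' unfolding compact_rep_def by auto
  \<comment> \<open>The larger start is the first common point of the two intervals, if they
    meet.\<close>
  let ?q = "\<lambda>p. max (start_of R' (a p)) (start_of R' (b p))"
  have q: "?q p \<le> end_of R' (a p)" "?q p \<le> end_of R' (b p)" if "p \<in> {1..c}" for p
  proof -
    \<comment> \<open>One vertex may play both roles, if its interval is the single point
      \<open>p\<close>; adjacency is specified only for distinct vertices.\<close>
    have "a p = b p \<or> {a p, b p} \<in> E"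
      using D(2)[OF i(1), of "a p" "b p"] D(1)[OF i(1), of "a p"] D(1)[OF i(1), of "b p"] a b that by force
    then show "?q p \<le> end_of R' (a p)" "?q p \<le> end_of R' (b p)"
      using D'(2)[OF i(2), of "a p" "b p"] D'(1)[OF i(2), of "a p"] D'(1)[OF i(2), of "b p"] a b that by force+
  qed
  have ne: "?q p \<noteq> ?q p'" if p: "p \<in> {1..c}" "p' \<in> {1..c}" "p < p'" for p p'
  proof
    assume "?q p = ?q p'"
    \<comment> \<open>A shared point would make an interval ending at \<open>p\<close> meet one
      starting at the later point \<open>p'\<close>.\<close>
    then have meet: "start_of R' (a p) \<le> end_of R' (b p')" "start_of R' (b p') \<le> end_of R' (a p)"
      using q[OF p(1)] q[OF p(2)] by linarith+
    have "a p \<noteq> b p'" using D(1)[OF i(1), of "a p"] a b p by force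
    then have "{a p, b p'} \<in> E" using D'(2)[OF i(2), of "a p" "b p'"] meet a b p by auto
    then show False using D(2)[OF i(1), of "a p" "b p'"] \<open>a p \<noteq> b p'\<close> a b p by force
  qed
  have "inj_on ?q {1..c}"
    by (rule linorder_inj_onI) (use ne in auto)
  moreover have "?q ` {1..c} \<subseteq> {1..c'}"
  proof
    fix x assume "x \<in> ?q ` {1..c}"
    then obtain p where p: "p \<in> {1..c}" "x = ?q p" by blast
    then show "x \<in> {1..c'}"
      using q(1)[OF p(1)] compact_repD[OF R', of "a p"] a[OF p(1)] by auto
  qed
  ultimately have "card {1..c} \<le> card {1..c'}" by (intro card_inj_on_le) auto
  then show ?thesis by simp
qed

section \<open>Restriction to a vertex set and renumbering of the points\<close>

definition squeeze :: "nat set \<Rightarrow> (nat \<Rightarrow> nat) \<Rightarrow> (nat \<Rightarrow> nat) \<Rightarrow> nat \<Rightarrow> nat" where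
  "squeeze K S E = block (\<lambda>p. p \<in> S ` K) (\<lambda>p. p \<in> E ` K)"

text \<open>Filtering and a monotone renumbering preserve the order by start points, so no sorting
  is required.\<close>

definition reduced :: "nat set \<Rightarrow> rep_list \<Rightarrow> rep_list" where
  "reduced K R = map (\<lambda>(v, s, e). (v, squeeze K (start_of R) (end_of R) s, squeeze K (start_of R) (end_of R) e))
     (filter (\<lambda>(v, s, e). v \<in> K) R)"

definition induced :: "nat set \<Rightarrow> edges \<Rightarrow> edges" where
  "induced K E = {e \<in> E. e \<subseteq> K}"

text \<open>The renumbering preserves every comparison of a start with an end, hence adjacency. Each
  block contains a start and an end point, so \<open>points_le_if_tight\<close> excludes a
  representation with fewer points.\<close>

lemma reduced_minimal:
  assumes R: "compact_rep c V E R" and K: "K \<subseteq> V" and "c \<le> N"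
  defines "F \<equiv> squeeze K (start_of R) (end_of R)"
  shows "compact_rep (F N) K (induced K E) (reduced K R)" (is ?A)
    "c_min K (induced K E) = F N"
    "\<And>q. q \<in> {1..F N} \<Longrightarrow> \<exists>v\<in>K. F (start_of R v) = q"
    "\<And>q. q \<in> {1..F N} \<Longrightarrow> \<exists>v\<in>K. F (end_of R v) = q"
proof -
  let ?st = "\<lambda>p. p \<in> start_of R ` K" and ?en = "\<lambda>p. p \<in> end_of R ` K"
  have F: "F = block ?st ?en" by (simp add: F_def squeeze_def)
  note V = compact_repD[OF R subsetD[OF K]]
  have dist: "distinct (map fst R)" and so: "sorted (map (\<lambda>(v, s, e). s) R)" and RV: "fst ` set R = V"
    using R by (auto simp: compact_rep_def)
  have m1: "fst ` set (reduced K R) = K"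
    using RV K by (force simp: reduced_def image_iff)
  have m2: "map fst (reduced K R) = map fst (filter (\<lambda>x. fst x \<in> K) R)"
    by (simp add: reduced_def case_prod_unfold comp_def)
  have dist': "distinct (map fst (reduced K R))"
    unfolding m2 by (intro distinct_map_filter dist)
  have ent: "start_of (reduced K R) v = F (start_of R v)" "end_of (reduced K R) v = F (end_of R v)" if "v \<in> K" for v
  proof -
    have "(v, F (start_of R v), F (end_of R v)) \<in> set (reduced K R)"
      using compact_rep_entry[OF R, of v] K that unfolding reduced_def F_def by force
    then show "start_of (reduced K R) v = F (start_of R v)" "end_of (reduced K R) v = F (end_of R v)"
      using compact_rep_mem[OF dist'] by blast+
  qed
  have st: "\<exists>v\<in>K. F (start_of R v) = q" if "q \<in> {1..F N}" for q
    using block_start[of q ?st ?en N] that F by auto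
  have en: "\<exists>v\<in>K. F (end_of R v) = q" if "q \<in> {1..F N}" for q
  proof -
    have "\<exists>e\<in>{p..N}. ?en e" if "p \<in> {1..N}" "?st p" for p
      using that V(2,3) \<open>c \<le> N\<close> by (fastforce intro: le_trans)
    then show ?thesis using block_end[of q ?st ?en N] that F by auto
  qed
  show st': "\<And>q. q \<in> {1..F N} \<Longrightarrow> \<exists>v\<in>K. F (start_of R v) = q" using st .
  show en': "\<And>q. q \<in> {1..F N} \<Longrightarrow> \<exists>v\<in>K. F (end_of R v) = q" using en .
  have mono: "p \<le> q \<Longrightarrow> F p \<le> F q" for p q unfolding F by (rule block_mono)
  have pos: "1 \<le> F (start_of R v)" if "v \<in> K" for v
    using block_less_if_fresh[of ?st ?en 0 "start_of R v"] V(1)[OF that] that F by auto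
  \<comment> \<open>If the end comes before the start, the state is fresh after the end, so the
    start gets a larger block. The other direction is monotonicity.\<close>
  have cmp: "F (start_of R u) \<le> F (end_of R v) \<longleftrightarrow> start_of R u \<le> end_of R v" if "u \<in> K" "v \<in> K" for u v
    using block_less_if_fresh[of ?st ?en "end_of R v" "start_of R u"] fresh_end[of ?en "end_of R v" ?st] mono[of "start_of R u" "end_of R v"] that F
    by (auto simp: not_le[symmetric])
  have bound: "F (end_of R v) \<le> F N" if "v \<in> K" for v using mono V(3)[OF that] \<open>c \<le> N\<close> by auto
  have i: "interval_rep V E (\<lambda>v. real (start_of R v)) (\<lambda>v. real (end_of R v))"
    using R unfolding compact_rep_def by auto
  show A: ?A
    unfolding compact_rep_def
  proof (intro conjI)
    show "interval_rep K (induced K E) (\<lambda>v. real (start_of (reduced K R) v)) (\<lambda>v. real (end_of (reduced K R) v))"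
    proof (rule interval_repI)
      fix u v assume uv: "u \<in> K" "v \<in> K" "u \<noteq> v"
      then have "{u, v} \<in> induced K E \<longleftrightarrow> {u, v} \<in> E" by (auto simp: induced_def)
      then show "{u, v} \<in> induced K E \<longleftrightarrow> start_of (reduced K R) u \<le> end_of (reduced K R) v \<and>
          start_of (reduced K R) v \<le> end_of (reduced K R) u"
        using interval_repD(2)[OF i, of u v] uv K ent cmp by auto
    qed (use ent mono V(2) in auto)
    have "sorted (map (\<lambda>(v, s, e). s) (filter (\<lambda>(v, s, e). v \<in> K) R))"
      by (rule sorted_filter[OF so])
    then have "sorted (map F (map (\<lambda>(v, s, e). s) (filter (\<lambda>(v, s, e). v \<in> K) R)))"
      by (rule sorted_map_mono) (use mono in \<open>auto intro: mono_onI\<close>)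
    also have "map F (map (\<lambda>(v, s, e). s) (filter (\<lambda>(v, s, e). v \<in> K) R)) = map (\<lambda>(v, s, e). s) (reduced K R)"
      by (simp add: reduced_def F_def case_prod_unfold)
    finally show "sorted (map (\<lambda>(v, s, e). s) (reduced K R))" .
    show "\<forall>(v, s, e)\<in>set (reduced K R). s \<in> {1..F N} \<and> e \<in> {1..F N}"
    proof clarify
      fix v s e assume "(v, s, e) \<in> set (reduced K R)"
      then have "v \<in> K" and "start_of (reduced K R) v = s" "end_of (reduced K R) v = e"
        using m1 compact_rep_mem[OF dist'] by force+
      then have "v \<in> K" "s = F (start_of R v)" "e = F (end_of R v)" using ent by auto
      then show "s \<in> {1..F N} \<and> e \<in> {1..F N}" 
        using pos bound V(2)[of v] mono[of "start_of R v" "end_of R v"] by (auto intro: le_trans)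
    qed
  qed (use m1 dist' in auto)
  show "c_min K (induced K E) = F N"
    unfolding c_min_def
  proof (rule Least_equality)
    show "compact (F N) K (induced K E)" using A by (auto simp: compact_def)
    fix c' assume "compact c' K (induced K E)"
    then obtain R' where "compact_rep c' K (induced K E) R'" by (auto simp: compact_def)
    then show "F N \<le> c'"
    proof (rule points_le_if_tight[OF A])
      show "\<exists>v\<in>K. start_of (reduced K R) v = p" "\<exists>v\<in>K. end_of (reduced K R) v = p"
        if "p \<in> {1..F N}" for p
        using st[OF that] en[OF that] ent by auto
    qed
  qed
qed

lemma induced_self: "simple_graph V E \<Longrightarrow> induced V E = E"
  by (auto simp: induced_def simple_graph_def)

text \<open>Renumbering a minimal representation with all vertices kept cannot save points: point
  \<open>c\<close> lies in block \<open>c\<close>. As blocks grow by at most one per point, the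
  renumbering is the identity, and each point inherits the start and the end that its block
  has.\<close>

lemma c_min_tight:
  assumes R: "compact_rep (c_min V E) V E R" and "simple_graph V E" and p: "p \<in> {1..c_min V E}"
  shows "\<exists>v\<in>V. start_of R v = p" "\<exists>v\<in>V. end_of R v = p"
proof -
  let ?c = "c_min V E"
  let ?st = "\<lambda>p. p \<in> start_of R ` V" and ?en = "\<lambda>p. p \<in> end_of R ` V"
  note M = reduced_minimal[OF R subset_refl le_refl, unfolded induced_self[OF assms(2)] squeeze_def]
  have id: "block ?st ?en q = q" if "q \<le> ?c" for q
  proof -
    have "block ?st ?en (q + (?c - q)) \<le> block ?st ?en q + (?c - q)" by (rule block_add)
    moreover have "block ?st ?en (0 + q) \<le> 0 + q"
      using block_add[of ?st ?en 0 q] by (simp del: add_0)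
    ultimately show ?thesis using M(2) that by (simp only: le_add_diff_inverse add_0)
  qed
  have *: "block ?st ?en ?c = ?c" using id by simp
  obtain v where v: "v \<in> V" "block ?st ?en (start_of R v) = p"
    using M(3)[of p] p unfolding * by blast
  have "start_of R v \<le> ?c" using compact_repD(2,3)[OF R v(1)] by simp
  then show "\<exists>v\<in>V. start_of R v = p" using v id by auto
  obtain w where w: "w \<in> V" "block ?st ?en (end_of R w) = p"
    using M(4)[of p] p unfolding * by blast
  then show "\<exists>v\<in>V. end_of R v = p" using compact_repD(3)[OF R w(1)] id by auto
qed

text \<open>Every point is the start of some vertex. This is what lets the number of vertices bound
  both the sweep over the points and the digits of the keys.\<close>

lemma c_min_le_card:
  assumes R: "compact_rep (c_min V E) V E R" and "simple_graph V E"
  shows "c_min V E \<le> card V"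
proof -
  have "{1..c_min V E} \<subseteq> start_of R ` V" using c_min_tight(1)[OF assms] by blast
  then have "card {1..c_min V E} \<le> card V"
    using assms(2) unfolding simple_graph_def by (intro surj_card_le) auto
  then show ?thesis by simp
qed

text \<open>
  In a minimal representation, an interval strictly inside another one is the middle leaf of a claw,
  which no proper interval graph contains.
\<close>

lemma proper_not_nested:
  assumes R: "compact_rep (c_min V E) V E R" and P: "proper_interval_graph V E"
    and uv: "u \<in> V" "v \<in> V" "start_of R u < start_of R v"
  shows "end_of R u \<le> end_of R v"
proof (rule ccontr)
  assume "\<not> end_of R u \<le> end_of R v"
  then have less: "end_of R v < end_of R u" by simp
  have sg: "simple_graph V E" using P by (simp add: proper_interval_graph_def)
  obtain l r where lr: "interval_rep V E l r" "\<forall>u\<in>V. \<forall>v\<in>V. \<not> {l u..r u} \<subset> {l v..r v}"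
    using P unfolding proper_interval_graph_def by blast
  have i: "interval_rep V E (\<lambda>v. real (start_of R v)) (\<lambda>v. real (end_of R v))"
    using R unfolding compact_rep_def by auto
  note B = compact_repD[OF R]
  \<comment> \<open>Tightness provides the outer leaves of the claw: \<open>a\<close> ends where
    \<open>u\<close> starts, and \<open>b\<close> starts where \<open>u\<close> ends. With
    \<open>v\<close> they are pairwise disjoint, and all three meet \<open>u\<close>.\<close>
  obtain a where a: "a \<in> V" "end_of R a = start_of R u"
    using c_min_tight(2)[OF R sg, of "start_of R u"] B[OF uv(1)] by force
  obtain b where b: "b \<in> V" "start_of R b = end_of R u"
    using c_min_tight(1)[OF R sg, of "end_of R u"] B[OF uv(1)] by force
  have E: "{x, y} \<in> E \<longleftrightarrow> start_of R x \<le> end_of R y \<and> start_of R y \<le> end_of R x"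
    if "x \<in> V" "y \<in> V" "x \<noteq> y" for x y
    using interval_repD(2)[OF i] that by blast
  have lr': "{x, y} \<in> E \<longleftrightarrow> l x \<le> r y \<and> l y \<le> r x" if "x \<in> V" "y \<in> V" "x \<noteq> y" for x y
    using lr(1) that interval_meet[of "l x" "r x" "l y" "r y"] unfolding interval_rep_def by auto
  have nonempty: "l x \<le> r x" if "x \<in> V" for x
    using lr(1) that unfolding interval_rep_def by auto
  have meet: "l u \<le> r x \<and> l x \<le> r u"
    if "x \<in> V" "start_of R u \<le> end_of R x" "start_of R x \<le> end_of R u" for x
    using E[OF uv(1) that(1)] lr'[OF uv(1) that(1)] nonempty[OF uv(1)] that(2,3) by blast
  have disjoint: "r x < l y \<or> r y < l x" if "x \<in> V" "y \<in> V" "end_of R x < start_of R y" for x y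
  proof -
    have "x \<noteq> y" using B(2)[OF that(1)] that(3) by auto
    then have "\<not> (l x \<le> r y \<and> l y \<le> r x)" using E[OF that(1,2)] lr'[OF that(1,2)] that(3) by simp
    then show ?thesis by linarith
  qed
  have inside: "\<not> (l u < l x \<and> r x < r u)" if "x \<in> V" for x
  proof
    assume "l u < l x \<and> r x < r u"
    then have "{l x..r x} \<subset> {l u..r u}" using nonempty[OF that] by (simp add: atLeastatMost_psubset_iff)
    then show False using lr(2) uv(1) that by blast
  qed
  have "l u \<le> r a \<and> l a \<le> r u" "l u \<le> r b \<and> l b \<le> r u" "l u \<le> r v \<and> l v \<le> r u"
    using meet[OF a(1)] meet[OF b(1)] meet[OF uv(2)] a b less uv(3) B(2)[OF a(1)] B(2)[OF b(1)]
      B(2)[OF uv(1)] B(2)[OF uv(2)] by linarith+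
  moreover have "r a < l v \<or> r v < l a" "r v < l b \<or> r b < l v" "r a < l b \<or> r b < l a"
    using disjoint[OF a(1) uv(2)] disjoint[OF uv(2) b(1)] disjoint[OF a(1) b(1)] a b less uv(3)
      B(2)[OF uv(2)] by linarith+
  \<comment> \<open>In the representation \<open>l\<close>, \<open>r\<close> the leaves may come in
    any order, but whichever is in the middle lies strictly inside \<open>u\<close>.\<close>
  ultimately show False
    using inside[OF a(1)] inside[OF b(1)] inside[OF uv(2)]
      nonempty[OF a(1)] nonempty[OF b(1)] nonempty[OF uv(2)] by linarith
qed

text \<open>Equal sums with different starts would put the interval that starts later strictly
  inside the other.\<close>

lemma proper_inj_sum:
  assumes "compact_rep (c_min V E) V E R" "proper_interval_graph V E"
    and "u \<in> V" "v \<in> V" "start_of R u + end_of R u = start_of R v + end_of R v"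
  shows "start_of R u = start_of R v" "end_of R u = end_of R v"
  using proper_not_nested[OF assms(1,2), of u v] proper_not_nested[OF assms(1,2), of v u] assms(3-5)
  by linarith+

section \<open>Kernels from dominating sets\<close>

text \<open>All vertices of \<open>S\<close> are replaced at once by \<open>h\<close>. Intervals
  only shrink, so nonadjacency survives; and \<open>h\<close> is injective on \<open>S\<close>,
  since two distinct vertices whose intervals contain the same interval are adjacent.\<close>

lemma union_is_yes_induced:
  assumes G: "simple_graph V E1" "simple_graph V E2"
    and R: "compact_rep c1 V E1 R1" "compact_rep c2 V E2 R2" and K: "K \<subseteq> V"
    and dom: "\<And>v. v \<in> V \<Longrightarrow> \<exists>u\<in>K. start_of R1 v \<le> start_of R1 u \<and> end_of R1 u \<le> end_of R1 v \<and>
      start_of R2 v \<le> start_of R2 u \<and> end_of R2 u \<le> end_of R2 v"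
  shows "union_is_yes K (induced K E1) (induced K E2) k \<longleftrightarrow> union_is_yes V E1 E2 k"
proof
  assume "union_is_yes K (induced K E1) (induced K E2) k"
  then obtain S where S: "independent_set K (induced K E1 \<union> induced K E2) S" "card S = k"
    unfolding union_is_yes_def by blast
  have "S \<subseteq> V" using S(1) K unfolding independent_set_def by (blast intro: subset_trans)
  moreover have "{u, v} \<notin> E1 \<union> E2" if "u \<in> S" "v \<in> S" for u v
  proof -
    have "{u, v} \<subseteq> K" "{u, v} \<notin> induced K E1 \<union> induced K E2"
      using S(1) that unfolding independent_set_def by blast+
    then show ?thesis unfolding induced_def by blast
  qed
  ultimately have "independent_set V (E1 \<union> E2) S" unfolding independent_set_def by blast
  then show "union_is_yes V E1 E2 k" using S(2) unfolding union_is_yes_def by blast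
next
  assume "union_is_yes V E1 E2 k"
  then obtain S where S: "S \<subseteq> V" "\<And>u v. u \<in> S \<Longrightarrow> v \<in> S \<Longrightarrow> {u, v} \<notin> E1 \<and> {u, v} \<notin> E2" "card S = k"
    unfolding union_is_yes_def independent_set_def by blast
  define h where "h v = (SOME u. u \<in> K \<and> start_of R1 v \<le> start_of R1 u \<and> end_of R1 u \<le> end_of R1 v \<and>
      start_of R2 v \<le> start_of R2 u \<and> end_of R2 u \<le> end_of R2 v)" for v
  have h: "h v \<in> K \<and> start_of R1 v \<le> start_of R1 (h v) \<and> end_of R1 (h v) \<le> end_of R1 v \<and>
      start_of R2 v \<le> start_of R2 (h v) \<and> end_of R2 (h v) \<le> end_of R2 v" if "v \<in> V" for v
    unfolding h_def by (rule someI_ex) (use dom[OF that] in blast)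
  have i: "interval_rep V E1 (\<lambda>v. real (start_of R1 v)) (\<lambda>v. real (end_of R1 v))"
    "interval_rep V E2 (\<lambda>v. real (start_of R2 v)) (\<lambda>v. real (end_of R2 v))"
    using R unfolding compact_rep_def by auto
  have hV: "h v \<in> V" if "v \<in> V" for v using h[OF that] K by blast
  have E1: "{u, v} \<in> E1" if "u \<in> V" "v \<in> V" "u \<noteq> v" "h u = h v \<or> {h u, h v} \<in> E1" for u v
  proof -
    have "start_of R1 (h u) \<le> end_of R1 (h v) \<and> start_of R1 (h v) \<le> end_of R1 (h u)"
      using interval_repD[OF i(1) hV[OF that(1)] hV[OF that(2)]] that(4)
      by (cases "h u = h v") auto
    then show ?thesis
      using interval_repD(2)[OF i(1) that(1-3)] h[OF that(1)] h[OF that(2)] by linarith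
  qed
  have E2: "{u, v} \<in> E2" if "u \<in> V" "v \<in> V" "u \<noteq> v" "{h u, h v} \<in> E2" "h u \<noteq> h v" for u v
  proof -
    have "start_of R2 (h u) \<le> end_of R2 (h v) \<and> start_of R2 (h v) \<le> end_of R2 (h u)"
      using interval_repD(2)[OF i(2) hV[OF that(1)] hV[OF that(2)]] that(4,5) by auto
    then show ?thesis
      using interval_repD(2)[OF i(2) that(1-3)] h[OF that(1)] h[OF that(2)] by linarith
  qed
  have inj: "inj_on h S"
  proof (intro inj_onI, rule ccontr)
    fix u v assume uv: "u \<in> S" "v \<in> S" "h u = h v" "u \<noteq> v"
    then have "{u, v} \<in> E1" using S(1) by (intro E1) auto
    then show False using S(2) uv by blast
  qed
  \<comment> \<open>\<open>independent_set\<close> also tests pairs with \<open>u = v\<close>, so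
    loops have to be excluded.\<close>
  have loop: "{u} \<notin> E1" "{u} \<notin> E2" for u
  proof -
    have "{u} \<notin> {{a, b} | a b. a \<in> V \<and> b \<in> V \<and> a \<noteq> b}" by auto
    then show "{u} \<notin> E1" "{u} \<notin> E2" using G unfolding simple_graph_def by blast+
  qed
  have "independent_set K (induced K E1 \<union> induced K E2) (h ` S)"
    unfolding independent_set_def
  proof (intro conjI ballI)
    show "h ` S \<subseteq> K" using h S(1) by blast
    fix x y assume "x \<in> h ` S" "y \<in> h ` S"
    then obtain u v where uv: "u \<in> S" "v \<in> S" "x = h u" "y = h v" by blast
    then have V: "u \<in> V" "v \<in> V" using S(1) by auto
    have "{x, y} \<notin> E1 \<and> {x, y} \<notin> E2"
    proof (cases "u = v")
      case True
      then show ?thesis using uv loop by simp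
    next
      case False
      then have "h u \<noteq> h v" using inj uv by (auto dest: inj_onD)
      then show ?thesis using E1[OF V False] E2[OF V False] S(2)[OF uv(1,2)] uv by blast
    qed
    then show "{x, y} \<notin> induced K E1 \<union> induced K E2" by (simp add: induced_def)
  qed
  moreover have "card (h ` S) = k" using card_image[OF inj] S(3) by simp
  ultimately show "union_is_yes K (induced K E1) (induced K E2) k"
    unfolding union_is_yes_def by blast
qed

lemma card_le_mult3:
  assumes "inj_on (\<lambda>v. (f v, g v, h v)) K"
    and "\<And>v. v \<in> K \<Longrightarrow> f v \<in> {1..a} \<and> g v \<in> {1..b} \<and> h v \<in> {1..c}"
  shows "card K \<le> a * (b * c)"
proof -
  have "card K \<le> card ({1..a} \<times> {1..b} \<times> {1..c})"
    by (rule card_inj_on_le[OF assms(1)]) (use assms(2) in blast, simp)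
  then show ?thesis by simp
qed

lemma card_le_if_proper:
  assumes R: "compact_rep (c_min V E) V E R" and P: "proper_interval_graph V E"
    and c: "c_min V E \<le> c" and K: "K \<subseteq> V"
    and inj: "inj_on (\<lambda>v. (f v, start_of R v, end_of R v)) K" and f: "\<And>v. v \<in> K \<Longrightarrow> f v \<in> {1..c}"
  shows "card K \<le> 2 * c\<^sup>2"
proof -
  \<comment> \<open>The dummy third component has a single value and turns the count of triples into
    one of pairs.\<close>
  have "inj_on (\<lambda>v. (f v, start_of R v + end_of R v, 1::nat)) K"
  proof (rule inj_onI)
    fix u v assume uv: "u \<in> K" "v \<in> K"
      "(f u, start_of R u + end_of R u, 1::nat) = (f v, start_of R v + end_of R v, 1)"
    then have "u \<in> V" "v \<in> V" "start_of R u + end_of R u = start_of R v + end_of R v"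
      using K by auto
    note proper_inj_sum[OF R P this]
    then show "u = v" using uv by (intro inj_onD[OF inj]) simp_all
  qed
  moreover have "f v \<in> {1..c} \<and> start_of R v + end_of R v \<in> {1..2 * c} \<and> 1 \<in> {1..1::nat}"
    if "v \<in> K" for v
    using f[OF that] compact_repD[OF R subsetD[OF K that]] c by (simp del: One_nat_def)
  ultimately have "card K \<le> c * (2 * c * 1)" by (rule card_le_mult3)
  then show ?thesis by (simp add: power2_eq_square)
qed

lemma simple_graph_induced:
  assumes "simple_graph V E" "K \<subseteq> V"
  shows "simple_graph K (induced K E)"
  unfolding simple_graph_def
proof (intro conjI subsetI)
  show "finite K" using assms unfolding simple_graph_def by (blast intro: finite_subset)
  fix e assume "e \<in> induced K E"
  then have e: "e \<in> E" "e \<subseteq> K" unfolding induced_def by blast+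
  then obtain u v where "e = {u, v}" "u \<noteq> v"
    using assms(1) unfolding simple_graph_def by blast
  then show "e \<in> {{u, v} | u v. u \<in> K \<and> v \<in> K \<and> u \<noteq> v}"
    using e(2) by blast
qed

lemma compact_rep_interval_graph:
  assumes "compact_rep c V E R" "simple_graph V E"
  shows "interval_graph V E"
proof -
  have "interval_rep V E (\<lambda>v. real (start_of R v)) (\<lambda>v. real (end_of R v))"
    using assms(1) unfolding compact_rep_def by simp
  then show ?thesis using assms(2) unfolding interval_graph_def by blast
qed

text \<open>Domination gives the equivalence, \<open>inj1\<close> the cubic bound. If a graph is
  proper, the triples containing its whole interval are counted: \<open>inj2\<close> for the first
  graph, \<open>inj1\<close> for the second.\<close>

lemma encodes_kernel:
  assumes G: "union_is_instance V E1 E2"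
    and R1: "compact_rep (c_min V E1) V E1 R1" and R2: "compact_rep (c_min V E2) V E2 R2"
    and K: "K \<subseteq> V"
    and dom: "\<And>v. v \<in> V \<Longrightarrow> \<exists>u\<in>K. start_of R1 v \<le> start_of R1 u \<and> end_of R1 u \<le> end_of R1 v \<and>
      start_of R2 v \<le> start_of R2 u \<and> end_of R2 u \<le> end_of R2 v"
    and inj1: "inj_on (\<lambda>v. (end_of R1 v, start_of R2 v, end_of R2 v)) K"
    and inj2: "inj_on (\<lambda>v. (end_of R2 v, start_of R1 v, end_of R1 v)) K"
  defines "E1' \<equiv> induced K E1" and "E2' \<equiv> induced K E2"
  shows "encodes_instance (encode (reduced K R1) (reduced K R2) k) K E1' E2' k"
    "union_is_yes K E1' E2' k \<longleftrightarrow> union_is_yes V E1 E2 k"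
    "c_all K E1' E2' \<le> c_all V E1 E2"
    "card K \<le> c_all V E1 E2 ^ 3"
    "proper_interval_graph V E1 \<or> proper_interval_graph V E2 \<Longrightarrow> card K \<le> 2 * (c_all V E1 E2)\<^sup>2"
proof -
  have sg: "simple_graph V E1" "simple_graph V E2"
    using G by (auto simp: union_is_instance_def interval_graph_def)
  note M1 = reduced_minimal[OF R1 K le_refl, folded E1'_def]
  note M2 = reduced_minimal[OF R2 K le_refl, folded E2'_def]
  have rep1: "compact_rep (c_min K E1') K E1' (reduced K R1)"
    and rep2: "compact_rep (c_min K E2') K E2' (reduced K R2)"
    using M1(1,2) M2(1,2) by simp_all
  have "simple_graph K E1'" "simple_graph K E2'"
    using sg K by (auto simp: E1'_def E2'_def intro: simple_graph_induced)
  then have "union_is_instance K E1' E2'"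
    using compact_rep_interval_graph[OF rep1] compact_rep_interval_graph[OF rep2]
    by (simp add: union_is_instance_def)
  then show "encodes_instance (encode (reduced K R1) (reduced K R2) k) K E1' E2' k"
    using rep1 rep2 unfolding encodes_instance_def by blast
  show "union_is_yes K E1' E2' k \<longleftrightarrow> union_is_yes V E1 E2 k"
    unfolding E1'_def E2'_def by (rule union_is_yes_induced[OF sg R1 R2 K dom])
  define c where "c = c_all V E1 E2"
  have "compact (max (c_min V E1) (c_min V E2)) V E1 \<and> compact (max (c_min V E1) (c_min V E2)) V E2"
    using compact_mono[OF R1 max.cobounded1] compact_mono[OF R2 max.cobounded2]
    unfolding compact_def by blast
  then have cc: "compact c V E1 \<and> compact c V E2" unfolding c_def c_all_def by (rule LeastI)
  then have c1: "c_min V E1 \<le> c" and c2: "c_min V E2 \<le> c"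
    unfolding c_min_def by (auto intro: Least_le)
  have le: "c_min K (induced K E) \<le> c" if "compact_rep (c_min V E) V E R" "c_min V E \<le> c" for E R
  proof -
    have "block st en (c_min V E) \<le> c_min V E" for st en
      using block_add[of st en 0 "c_min V E"] by simp
    then have "c_min K (induced K E) \<le> c_min V E"
      using reduced_minimal(2)[OF that(1) K le_refl] by (simp add: squeeze_def)
    then show ?thesis using that(2) by simp
  qed
  have "compact c K E1' \<and> compact c K E2'"
    using compact_mono[OF rep1] compact_mono[OF rep2] le[OF R1 c1] le[OF R2 c2]
    unfolding compact_def E1'_def E2'_def by blast
  then show "c_all K E1' E2' \<le> c_all V E1 E2"
    unfolding c_def[symmetric] c_all_def[of K] by (rule Least_le)
  have B1: "start_of R1 v \<in> {1..c} \<and> end_of R1 v \<in> {1..c}" if "v \<in> K" for v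
    using compact_repD[OF R1 subsetD[OF K that]] c1 by simp
  have B2: "start_of R2 v \<in> {1..c} \<and> end_of R2 v \<in> {1..c}" if "v \<in> K" for v
    using compact_repD[OF R2 subsetD[OF K that]] c2 by simp
  have "card K \<le> c * (c * c)" using B1 B2 by (intro card_le_mult3[OF inj1]) blast
  then show "card K \<le> c_all V E1 E2 ^ 3" by (simp add: c_def[symmetric] power3_eq_cube)
  have "card K \<le> 2 * c\<^sup>2" if "proper_interval_graph V E1 \<or> proper_interval_graph V E2"
    using that
  proof
    assume "proper_interval_graph V E1"
    then show ?thesis by (rule card_le_if_proper[OF R1 _ c1 K inj2]) (use B2 in blast)
  next
    assume "proper_interval_graph V E2"
    then show ?thesis by (rule card_le_if_proper[OF R2 _ c2 K inj1]) (use B1 in blast)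
  qed
  then show "card K \<le> 2 * (c_all V E1 E2)\<^sup>2"
    if "proper_interval_graph V E1 \<or> proper_interval_graph V E2"
    using that by (simp add: c_def)
qed

section \<open>The kernelization program\<close>

text \<open>
  The memory above the input holds twelve interleaved arrays. For the graphs \<open>g = 0, 1\<close>: arrays \<open>g\<close> and
  \<open>2 + g\<close> map vertices to start and end points, array \<open>4 + g\<close> maps keys to vertices (increased by one,
  as \<open>0\<close> means that the key did not occur), arrays \<open>6 + g\<close> and \<open>8 + g\<close> mark the start and end points
  of the remaining vertices, and array \<open>10 + g\<close> maps points to blocks. No initialization is needed,
  and the huge address space makes up for sorting and searching.
\<close>

definition arr :: "nat \<Rightarrow> (nat \<Rightarrow> nat) \<Rightarrow> nat \<Rightarrow> nat \<Rightarrow> nat" where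
  "arr L mem j i = mem (L + (12 * i + j))"

definition aset :: "nat \<Rightarrow> nat \<Rightarrow> nat \<Rightarrow> nat \<Rightarrow> (nat \<Rightarrow> nat) \<Rightarrow> nat \<Rightarrow> nat" where
  "aset L j i x mem = mem(L + (12 * i + j) := x)"

definition arr_addr :: "nat \<Rightarrow> rexp \<Rightarrow> rexp" where
  "arr_addr j e = Add (Reg 0) (Add (Mul (Const 12) e) (Const j))"

definition Arr :: "nat \<Rightarrow> rexp \<Rightarrow> rexp" where
  "Arr j e = Mem (arr_addr j e)"

definition SetArr :: "nat \<Rightarrow> rexp \<Rightarrow> rexp \<Rightarrow> com" where
  "SetArr j e x = Store (arr_addr j e) x"

text \<open>Two header cells precede the triples. Those of the second graph follow the
  \<open>n\<close> triples of the first, with \<open>n\<close> in register \<open>1\<close> and the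
  position in register \<open>2\<close>.\<close>

definition entry :: "nat \<Rightarrow> nat \<Rightarrow> rexp" where
  "entry g j = Mem (Add (Const (2 + j)) (Mul (Const 3) (Add (Reg 2) (Mul (Const g) (Reg 1)))))"

definition load :: "nat \<Rightarrow> com" where
  "load g = Seq (Assign 3 (entry g 0)) (Seq (Assign 4 (entry g 1)) (Assign 5 (entry g 2)))"

text \<open>A number with three digits in base \<open>L\<close>, the input length. As points are at
  most \<open>n < L\<close>, distinct triples get distinct keys.\<close>

definition key_of :: "nat \<Rightarrow> nat \<Rightarrow> nat \<Rightarrow> nat \<Rightarrow> nat" where
  "key_of L a b c = (a * L + b) * L + c"

text \<open>The digits are the end in graph \<open>g\<close> and the start and end in the other
  graph, found in arrays \<open>1 - g\<close> and \<open>3 - g\<close>. The expression is expanded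
  wherever it is used, as its value may be too large to be stored.\<close>

definition key_exp :: "nat \<Rightarrow> rexp" where
  "key_exp g = Add (Mul (Add (Mul (Arr (2 + g) (Reg 3)) (Reg 0)) (Arr (1 - g) (Reg 3))) (Reg 0))
     (Arr (3 - g) (Reg 3))"

text \<open>Truncated subtraction both ways tests for inequality.\<close>

definition not_champion :: "nat \<Rightarrow> rexp" where
  "not_champion g = Add (Sub (Arr (4 + g) (key_exp g)) (Add (Reg 3) (Const 1)))
     (Sub (Add (Reg 3) (Const 1)) (Arr (4 + g) (key_exp g)))"

definition fill_body :: "nat \<Rightarrow> com" where
  "fill_body g = Seq (load g) (Seq (SetArr g (Reg 3) (Reg 4)) (SetArr (2 + g) (Reg 3) (Reg 5)))"

definition champion_body :: "nat \<Rightarrow> rexp \<Rightarrow> com" where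
  "champion_body g b = Seq (load g)
     (IfNZ b Skip (SetArr (4 + g) (key_exp g) (Add (Reg 3) (Const 1))))"

text \<open>The test is \<open>not_champion 1\<close> for both graphs: the survivors of the second
  round are the final ones.\<close>

definition mark_body :: "nat \<Rightarrow> com" where
  "mark_body g = Seq (load g) (IfNZ (not_champion 1) Skip
     (Seq (SetArr (6 + g) (Reg 4) (Const 1)) (SetArr (8 + g) (Reg 5) (Const 1))))"

text \<open>Register \<open>6\<close> is the current block and register \<open>7\<close> the
  freshness flag as a number, so that adding it opens a block exactly when the state is fresh. The
  start is treated before the end, so that both at one point fall into the same block. Points begin
  with \<open>1\<close>, the counter with \<open>0\<close>.\<close>

definition sweep_body :: "nat \<Rightarrow> com" where
  "sweep_body g = (let p = Add (Reg 2) (Const 1) in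
     Seq (IfNZ (Arr (6 + g) p) (Seq (Assign 6 (Add (Reg 6) (Reg 7))) (Assign 7 (Const 0))) Skip)
     (Seq (IfNZ (Arr (8 + g) p) (Assign 7 (Const 1)) Skip)
       (SetArr (10 + g) p (Reg 6))))"

definition sweep_loop :: "nat \<Rightarrow> com" where
  "sweep_loop g = Seq (Assign 6 (Const 0)) (Seq (Assign 7 (Const 1)) (For (sweep_body g)))"

text \<open>Register \<open>6\<close> is the next free output cell. The output overwrites the input,
  which is harmless since at most one triple is written per triple read.\<close>

definition output_body :: "nat \<Rightarrow> com" where
  "output_body g = Seq (load g) (IfNZ (not_champion 1) Skip
     (Seq (Store (Reg 6) (Reg 3))
     (Seq (Store (Add (Reg 6) (Const 1)) (Arr (10 + g) (Reg 4)))
     (Seq (Store (Add (Reg 6) (Const 2)) (Arr (10 + g) (Reg 5)))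
       (Assign 6 (Add (Reg 6) (Const 3)))))))"

text \<open>Register \<open>1\<close> keeps the original \<open>n\<close>, by which the second input
  list is still located after the number of survivors has replaced it in cell \<open>1\<close>. Cell
  \<open>0\<close> holds \<open>k\<close> and stays as it is.\<close>

definition kernelize :: com where
  "kernelize =
     Seq (Assign 1 (Mem (Const 1)))
    (Seq (For (fill_body 0))
    (Seq (For (fill_body 1))
    (Seq (For (champion_body 0 (Const 0)))
    (Seq (For (champion_body 1 (not_champion 0)))
    (Seq (For (mark_body 0))
    (Seq (For (mark_body 1))
    (Seq (sweep_loop 0)
    (Seq (sweep_loop 1)
    (Seq (Assign 6 (Const 2))
    (Seq (For (output_body 0))
    (Seq (Store (Const 1) (Div (Sub (Reg 6) (Const 2)) (Const 3)))
    (Seq (For (output_body 1))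
         (Assign 0 (Reg 6))))))))))))))"

section \<open>Arrays, keys and the layout of the input\<close>

lemma rval_Arr [simp]: "rval (r, mem) (Arr j e) = arr (r 0) mem j (rval (r, mem) e)"
  by (simp add: Arr_def arr_addr_def arr_def)

lemma wp_SetArr [simp]:
  "wp m (SetArr j e x) Q (r, mem) \<longleftrightarrow> rval (r, mem) x < m \<and>
     Q (r, aset (r 0) j (rval (r, mem) e) (rval (r, mem) x) mem)"
  by (simp add: SetArr_def arr_addr_def aset_def)

text \<open>The residue modulo 12 of the offset identifies the array, so arrays of unbounded length
  do not overlap.\<close>

lemma arr_aset [simp]:
  assumes "j < 12" "j' < 12"
  shows "arr L (aset L j i x mem) j' = (if j' = j then (arr L mem j)(i := x) else arr L mem j')"
proof
  fix i'
  have "12 * i' + j' = 12 * i + j \<longleftrightarrow> i' = i \<and> j' = j"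
  proof
    assume eq: "12 * i' + j' = 12 * i + j"
    have "(12 * i' + j') mod 12 = j'" "(12 * i + j) mod 12 = j" using assms by simp_all
    then have "j' = j" using eq by simp
    then show "i' = i \<and> j' = j" using eq by simp
  qed simp
  then show "arr L (aset L j i x mem) j' i' =
      (if j' = j then (arr L mem j)(i := x) else arr L mem j') i'"
    by (auto simp: arr_def aset_def)
qed

lemma arr_upd_low [simp]: "a < L \<Longrightarrow> arr L (mem(a := x)) = arr L mem"
  by (auto simp: arr_def fun_eq_iff)

lemma key_of_inject:
  assumes "key_of L a b c = key_of L a' b' c'" "b < L" "c < L" "b' < L" "c' < L"
  shows "a = a'" "b = b'" "c = c'"
proof -
  have dm: "x = x'" "y = y'" if "x * L + y = x' * L + y'" "y < L" "y' < L" for x y x' y'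
  proof -
    have "(x * L + y) div L = (x' * L + y') div L" "(x * L + y) mod L = (x' * L + y') mod L"
      using that(1) by simp_all
    then show "x = x'" "y = y'" using that(2,3) by simp_all
  qed
  note 1 = assms(1)[unfolded key_of_def]
  note 2 = dm(1)[OF 1 assms(3,5)]
  show "c = c'" by (rule dm(2)[OF 1 assms(3,5)])
  show "a = a'" by (rule dm(1)[OF 2 assms(2,4)])
  show "b = b'" by (rule dm(2)[OF 2 assms(2,4)])
qed

lemma all_less_2_iff: "(\<forall>g<2. P g) \<longleftrightarrow> P (0::nat) \<and> P 1"
  by (auto dest!: less_2_cases)

text \<open>The input seen through functions: \<open>vv g i\<close> is the vertex at position
  \<open>i\<close> in the list of graph \<open>g\<close>, and \<open>S g\<close>, \<open>E g\<close>
  give start and end points. The bound \<open>n\<close> on the points stems from minimality,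
  \<open>mono\<close> from the order of the lists.\<close>

locale kernel_input =
  fixes m n L :: nat and xs :: "nat list" and V :: "nat set"
    and S E vv :: "nat \<Rightarrow> nat \<Rightarrow> nat"
  assumes L: "L = 2 + 6 * n" and Lm: "L < m"
    and len: "length xs = L" and xs1: "xs ! 1 = n"
    and ent: "\<And>g i. g < 2 \<Longrightarrow> i < n \<Longrightarrow> xs ! (2 + 3 * (i + g * n)) = vv g i \<and>
      xs ! (3 + 3 * (i + g * n)) = S g (vv g i) \<and> xs ! (4 + 3 * (i + g * n)) = E g (vv g i)"
    and vv: "\<And>g. g < 2 \<Longrightarrow> bij_betw (vv g) {..<n} V"
    and Vm: "\<And>v. v \<in> V \<Longrightarrow> v + 1 < m"
    and S: "\<And>g v. g < 2 \<Longrightarrow> v \<in> V \<Longrightarrow> 1 \<le> S g v" "\<And>g v. g < 2 \<Longrightarrow> v \<in> V \<Longrightarrow> S g v \<le> E g v"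
    and E: "\<And>g v. g < 2 \<Longrightarrow> v \<in> V \<Longrightarrow> E g v \<le> n"
    and mono: "\<And>g i j. g < 2 \<Longrightarrow> i \<le> j \<Longrightarrow> j < n \<Longrightarrow> S g (vv g i) \<le> S g (vv g j)"
begin

definition intact :: "(nat \<Rightarrow> nat) \<Rightarrow> bool" where
  "intact mem \<longleftrightarrow> (\<forall>a<L. mem a = xs ! a)"

definition filled :: "(nat \<Rightarrow> nat) \<Rightarrow> bool" where
  "filled mem \<longleftrightarrow> (\<forall>g<2. \<forall>v\<in>V. arr L mem g v = S g v \<and> arr L mem (2 + g) v = E g v)"

definition frame :: "nat set \<Rightarrow> (nat \<Rightarrow> nat \<Rightarrow> nat) \<Rightarrow> (nat \<Rightarrow> nat) \<Rightarrow> bool" where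
  "frame J A mem \<longleftrightarrow> (\<forall>j<12. j \<notin> J \<longrightarrow> arr L mem j = A j)"

definition key :: "nat \<Rightarrow> nat \<Rightarrow> nat" where
  "key g v = key_of L (E g v) (S (1 - g) v) (E (1 - g) v)"

lemma vvV: "g < 2 \<Longrightarrow> i < n \<Longrightarrow> vv g i \<in> V"
  using vv[of g] by (auto simp: bij_betw_def)

lemma Vvv: "g < 2 \<Longrightarrow> v \<in> V \<Longrightarrow> \<exists>i<n. vv g i = v"
  using vv[of g] by (auto simp: bij_betw_def image_iff)

lemma nm: "n < m" "Suc 0 < m" "n < L"
  using L Lm by auto

lemma SEm: "g < 2 \<Longrightarrow> v \<in> V \<Longrightarrow> S g v < m" "g < 2 \<Longrightarrow> v \<in> V \<Longrightarrow> E g v < m"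
  using S[of g v] E[of g v] nm by linarith+

lemma SEL: "g < 2 \<Longrightarrow> v \<in> V \<Longrightarrow> S g v < L" "g < 2 \<Longrightarrow> v \<in> V \<Longrightarrow> E g v < L"
  using S[of g v] E[of g v] nm by linarith+

lemma key_eqD:
  assumes "key g u = key g v" "g < 2" "u \<in> V" "v \<in> V"
  shows "E g u = E g v" "S (1 - g) u = S (1 - g) v" "E (1 - g) u = E (1 - g) v"
proof -
  have "1 - g < 2" using assms(2) by simp
  note SEL = SEL[OF this assms(3)] SEL[OF this assms(4)]
  show "E g u = E g v" "S (1 - g) u = S (1 - g) v" "E (1 - g) u = E (1 - g) v"
    by (rule key_of_inject[OF assms(1)[unfolded key_def]]; rule SEL)+
qed

lemma intact_aset [simp]: "intact (aset L j i x mem) \<longleftrightarrow> intact mem"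
  by (auto simp: intact_def aset_def)

lemma filled_aset [simp]: "4 \<le> j \<Longrightarrow> j < 12 \<Longrightarrow> filled (aset L j i x mem) \<longleftrightarrow> filled mem"
  by (auto simp: filled_def)

lemma frame_aset [simp]: "j < 12 \<Longrightarrow> j \<in> J \<Longrightarrow> frame J A (aset L j i x mem) \<longleftrightarrow> frame J A mem"
  by (auto simp: frame_def)

text \<open>The input is assumed intact only from the current triple on, since the output phase
  overwrites what has been read.\<close>

lemma wp_load:
  assumes g: "g < 2" and i: "i < n" and r: "r 1 = n" "r 2 = i"
    and mem: "\<And>a. 2 + 3 * (i + g * n) \<le> a \<Longrightarrow> a < L \<Longrightarrow> mem a = xs ! a"
    and p: "wp m p Q (r(3 := vv g i, 4 := S g (vv g i), 5 := E g (vv g i)), mem)"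
  shows "wp m (Seq (load g) p) Q (r, mem)"
proof -
  have "g = 0 \<or> g = 1" using g by auto
  then have lt: "4 + 3 * (i + g * n) < L" using i L by auto
  have "mem (2 + 3 * (i + g * n)) = vv g i" "mem (3 + 3 * (i + g * n)) = S g (vv g i)"
    "mem (4 + 3 * (i + g * n)) = E g (vv g i)"
    using mem[of "2 + 3 * (i + g * n)"] mem[of "3 + 3 * (i + g * n)"] mem[of "4 + 3 * (i + g * n)"]
      ent[OF g i] lt by simp_all
  moreover have "vv g i < m" using Vm[OF vvV[OF g i]] by simp
  ultimately show ?thesis
    using p r SEm[OF g vvV[OF g i]]
    by (simp add: load_def entry_def numeral_2_eq_2[symmetric] add.commute)
qed

lemma rval_key_exp:
  assumes "g < 2" "filled mem" "r 0 = L" "r 3 \<in> V"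
  shows "rval (r, mem) (key_exp g) = key g (r 3)"
proof -
  have "3 - g = 2 + (1 - g)" using assms(1) by simp
  then show ?thesis
    using assms unfolding key_exp_def key_def key_of_def filled_def by simp
qed

lemma rval_not_champion:
  assumes "g < 2" "filled mem" "r 0 = L" "r 3 \<in> V"
  shows "rval (r, mem) (not_champion g) = 0 \<longleftrightarrow> arr L mem (4 + g) (key g (r 3)) = r 3 + 1"
  using rval_key_exp[OF assms] assms(3) by (auto simp: not_champion_def)

section \<open>Invariants of the loops\<close>

lemma run_fill:
  assumes g: "g < 2" and s: "fst s 0 = L" "fst s 1 = n" "intact (snd s)" "frame J A (snd s)"
  shows "runs m n (For (fill_body g)) s (\<lambda>s'. fst s' 0 = L \<and> fst s' 1 = n \<and> intact (snd s') \<and>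
    frame (J \<union> {g, 2 + g}) A (snd s') \<and>
    (\<forall>h<2. h \<noteq> g \<longrightarrow> arr L (snd s') h = arr L (snd s) h \<and> arr L (snd s') (2 + h) = arr L (snd s) (2 + h)) \<and>
    (\<forall>v\<in>V. arr L (snd s') g v = S g v \<and> arr L (snd s') (2 + g) v = E g v))"
proof -
  define I where "I i mem x y \<longleftrightarrow> intact mem \<and> frame (J \<union> {g, 2 + g}) A mem \<and>
    (\<forall>h<2. h \<noteq> g \<longrightarrow> arr L mem h = arr L (snd s) h \<and> arr L mem (2 + h) = arr L (snd s) (2 + h)) \<and>
    (\<forall>i'<i. arr L mem g (vv g i') = S g (vv g i') \<and> arr L mem (2 + g) (vv g i') = E g (vv g i'))"
    for i mem and x y :: nat
  have "runs m n (For (fill_body g)) s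
      (\<lambda>s'. fst s' 0 = L \<and> fst s' 1 = n \<and> I n (snd s') (fst s' 6) (fst s' 7))"
  proof (rule runs_For)
    show "I 0 (snd s) (fst s 6) (fst s 7)" using s by (simp add: I_def frame_def)
    fix i and r mem :: "nat \<Rightarrow> nat"
    assume i: "i < n" and r: "r 0 = L" "r 1 = n" "r 2 = i" and I: "I i mem (r 6) (r 7)"
    show "wp m (fill_body g) (\<lambda>s'. fst s' 0 = L \<and> fst s' 1 = n \<and> fst s' 2 = i \<and>
        I (Suc i) (snd s') (fst s' 6) (fst s' 7)) (r, mem)"
      unfolding fill_body_def
    proof (rule wp_load[OF g i r(2,3)])
      show "mem a = xs ! a" if "a < L" for a using I that by (simp add: I_def intact_def)
      show "wp m (Seq (SetArr g (Reg 3) (Reg 4)) (SetArr (2 + g) (Reg 3) (Reg 5)))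
         (\<lambda>s'. fst s' 0 = L \<and> fst s' 1 = n \<and> fst s' 2 = i \<and> I (Suc i) (snd s') (fst s' 6) (fst s' 7))
         (r(3 := vv g i, 4 := S g (vv g i), 5 := E g (vv g i)), mem)"
        using I r g SEm[OF g vvV[OF g i]] by (auto simp: I_def frame_def less_Suc_eq)
    qed
  qed (use s nm in auto)
  then show ?thesis
    by (rule runs_conseq) (use Vvv[OF g] in \<open>fastforce simp: I_def\<close>)
qed

definition champions :: "nat \<Rightarrow> nat set \<Rightarrow> nat \<Rightarrow> (nat \<Rightarrow> nat) \<Rightarrow> bool" where
  "champions g C i t \<longleftrightarrow>
     (\<forall>x. t x \<noteq> 0 \<longrightarrow> (\<exists>j<i. vv g j \<in> C \<and> t x = vv g j + 1 \<and> key g (vv g j) = x)) \<and>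
     (\<forall>j<i. vv g j \<in> C \<longrightarrow> (\<exists>j'<i. j \<le> j' \<and> t (key g (vv g j)) = vv g j' + 1))"

lemma champions_Suc:
  assumes "champions g C i t"
  shows "champions g C (Suc i) (if vv g i \<in> C then t(key g (vv g i) := vv g i + 1) else t)"
  using assms unfolding champions_def by (auto simp: less_Suc_eq)

lemma run_champion:
  assumes g: "g < 2" and s: "fst s 0 = L" "fst s 1 = n" "intact (snd s)" "frame {} A (snd s)" "filled (snd s)"
    and A: "A (4 + g) = (\<lambda>_. 0)"
    and b: "\<And>r mem. r 0 = L \<Longrightarrow> r 3 \<in> V \<Longrightarrow> filled mem \<Longrightarrow> frame {4 + g} A mem \<Longrightarrow>
      rval (r, mem) b = 0 \<longleftrightarrow> r 3 \<in> C"
  shows "runs m n (For (champion_body g b)) s (\<lambda>s'. fst s' 0 = L \<and> fst s' 1 = n \<and> intact (snd s') \<and>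
    filled (snd s') \<and> frame {4 + g} A (snd s') \<and> champions g C n (arr L (snd s') (4 + g)))"
proof -
  define I where "I i mem x y \<longleftrightarrow> intact mem \<and> filled mem \<and> frame {4 + g} A mem \<and>
    champions g C i (arr L mem (4 + g))" for i mem and x y :: nat
  have "runs m n (For (champion_body g b)) s
      (\<lambda>s'. fst s' 0 = L \<and> fst s' 1 = n \<and> I n (snd s') (fst s' 6) (fst s' 7))"
  proof (rule runs_For)
    show "I 0 (snd s) (fst s 6) (fst s 7)" using s A g by (simp add: I_def frame_def champions_def)
    fix i and r mem :: "nat \<Rightarrow> nat"
    assume i: "i < n" and r: "r 0 = L" "r 1 = n" "r 2 = i" and I: "I i mem (r 6) (r 7)"
    let ?r = "r(3 := vv g i, 4 := S g (vv g i), 5 := E g (vv g i))"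
    have key: "rval (?r, mem) (key_exp g) = key g (vv g i)"
      using rval_key_exp[OF g, of mem ?r] I r vvV[OF g i] by (simp add: I_def)
    have bC: "rval (?r, mem) b = 0 \<longleftrightarrow> vv g i \<in> C"
      using b[of ?r mem] I r vvV[OF g i] by (simp add: I_def)
    show "wp m (champion_body g b) (\<lambda>s'. fst s' 0 = L \<and> fst s' 1 = n \<and> fst s' 2 = i \<and>
        I (Suc i) (snd s') (fst s' 6) (fst s' 7)) (r, mem)"
      unfolding champion_body_def
    proof (rule wp_load[OF g i r(2,3)])
      show "mem a = xs ! a" if "a < L" for a using I that by (simp add: I_def intact_def)
      show "wp m (IfNZ b Skip (SetArr (4 + g) (key_exp g) (Add (Reg 3) (Const 1))))
         (\<lambda>s'. fst s' 0 = L \<and> fst s' 1 = n \<and> fst s' 2 = i \<and> I (Suc i) (snd s') (fst s' 6) (fst s' 7))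
         (?r, mem)"
      proof (cases "vv g i \<in> C")
        case True
        then show ?thesis
          using I r g key bC Vm[OF vvV[OF g i]] champions_Suc[of g C i "arr L mem (4 + g)"]
          by (simp add: I_def)
      next
        case False
        then show ?thesis
          using I r bC champions_Suc[of g C i "arr L mem (4 + g)"] by (simp add: I_def)
      qed
    qed
  qed (use s nm in auto)
  then show ?thesis by (rule runs_conseq) (simp add: I_def)
qed

lemma run_mark:
  assumes g: "g < 2" and s: "fst s 0 = L" "fst s 1 = n" "intact (snd s)" "frame {} A (snd s)" "filled (snd s)"
    and A: "A (6 + g) = (\<lambda>_. 0)" "A (8 + g) = (\<lambda>_. 0)"
    and K: "K \<subseteq> V" "\<And>v. v \<in> V \<Longrightarrow> A 5 (key 1 v) = v + 1 \<longleftrightarrow> v \<in> K"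
  shows "runs m n (For (mark_body g)) s (\<lambda>s'. fst s' 0 = L \<and> fst s' 1 = n \<and> intact (snd s') \<and>
    filled (snd s') \<and> frame {6 + g, 8 + g} A (snd s') \<and>
    (\<forall>p. arr L (snd s') (6 + g) p \<noteq> 0 \<longleftrightarrow> p \<in> S g ` K) \<and>
    (\<forall>p. arr L (snd s') (8 + g) p \<noteq> 0 \<longleftrightarrow> p \<in> E g ` K))"
proof -
  define I where "I i mem x y \<longleftrightarrow> intact mem \<and> filled mem \<and> frame {6 + g, 8 + g} A mem \<and>
    (\<forall>p. arr L mem (6 + g) p \<noteq> 0 \<longleftrightarrow> (\<exists>j<i. vv g j \<in> K \<and> S g (vv g j) = p)) \<and>
    (\<forall>p. arr L mem (8 + g) p \<noteq> 0 \<longleftrightarrow> (\<exists>j<i. vv g j \<in> K \<and> E g (vv g j) = p))"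
    for i mem and x y :: nat
  have "runs m n (For (mark_body g)) s
      (\<lambda>s'. fst s' 0 = L \<and> fst s' 1 = n \<and> I n (snd s') (fst s' 6) (fst s' 7))"
  proof (rule runs_For)
    show "I 0 (snd s) (fst s 6) (fst s 7)" using s A g by (simp add: I_def frame_def)
    fix i and r mem :: "nat \<Rightarrow> nat"
    assume i: "i < n" and r: "r 0 = L" "r 1 = n" "r 2 = i" and I: "I i mem (r 6) (r 7)"
    let ?r = "r(3 := vv g i, 4 := S g (vv g i), 5 := E g (vv g i))"
    have A5: "arr L mem 5 = A 5" using I g unfolding I_def frame_def by simp
    have bK: "rval (?r, mem) (not_champion 1) = 0 \<longleftrightarrow> vv g i \<in> K"
      using rval_not_champion[of 1 mem ?r] I r vvV[OF g i] K(2)[OF vvV[OF g i]] A5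
      by (simp add: I_def)
    show "wp m (mark_body g) (\<lambda>s'. fst s' 0 = L \<and> fst s' 1 = n \<and> fst s' 2 = i \<and>
        I (Suc i) (snd s') (fst s' 6) (fst s' 7)) (r, mem)"
      unfolding mark_body_def
    proof (rule wp_load[OF g i r(2,3)])
      show "mem a = xs ! a" if "a < L" for a using I that by (simp add: I_def intact_def)
      show "wp m (IfNZ (not_champion 1) Skip
           (Seq (SetArr (6 + g) (Reg 4) (Const 1)) (SetArr (8 + g) (Reg 5) (Const 1))))
         (\<lambda>s'. fst s' 0 = L \<and> fst s' 1 = n \<and> fst s' 2 = i \<and> I (Suc i) (snd s') (fst s' 6) (fst s' 7))
         (?r, mem)"
      proof (cases "vv g i \<in> K")
        case True
        then show ?thesis
          using I r g bK nm by (auto simp: I_def less_Suc_eq)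
      next
        case False
        then show ?thesis using I r bK by (auto simp: I_def less_Suc_eq)
      qed
    qed
  qed (use s nm in auto)
  then show ?thesis
  proof (rule runs_conseq)
    fix s' assume *: "fst s' 0 = L \<and> fst s' 1 = n \<and> I n (snd s') (fst s' 6) (fst s' 7)"
    have "(\<exists>j<n. vv g j \<in> K \<and> f (vv g j) = p) \<longleftrightarrow> p \<in> f ` K" for f :: "nat \<Rightarrow> nat" and p
      using Vvv[OF g] vvV[OF g] K(1) by blast
    then show "fst s' 0 = L \<and> fst s' 1 = n \<and> intact (snd s') \<and>
      filled (snd s') \<and> frame {6 + g, 8 + g} A (snd s') \<and>
      (\<forall>p. arr L (snd s') (6 + g) p \<noteq> 0 \<longleftrightarrow> p \<in> S g ` K) \<and>
      (\<forall>p. arr L (snd s') (8 + g) p \<noteq> 0 \<longleftrightarrow> p \<in> E g ` K)"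
      using * unfolding I_def by simp
  qed
qed

lemma run_sweep:
  assumes g: "g < 2" and s: "fst s 0 = L" "fst s 1 = n" "intact (snd s)" "frame {} A (snd s)" "filled (snd s)"
    and A: "\<And>p. A (6 + g) p \<noteq> 0 \<longleftrightarrow> p \<in> S g ` K" "\<And>p. A (8 + g) p \<noteq> 0 \<longleftrightarrow> p \<in> E g ` K"
  shows "runs m n (sweep_loop g) s (\<lambda>s'. fst s' 0 = L \<and> fst s' 1 = n \<and> intact (snd s') \<and>
    filled (snd s') \<and> frame {10 + g} A (snd s') \<and>
    (\<forall>p\<in>{1..n}. arr L (snd s') (10 + g) p = squeeze K (S g) (E g) p))"
proof -
  let ?b = "block (\<lambda>p. p \<in> S g ` K) (\<lambda>p. p \<in> E g ` K)"
  let ?f = "fresh (\<lambda>p. p \<in> S g ` K) (\<lambda>p. p \<in> E g ` K)"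
  define I where "I i mem x y \<longleftrightarrow> intact mem \<and> filled mem \<and> frame {10 + g} A mem \<and>
    x = ?b i \<and> y = of_bool (?f i) \<and> (\<forall>p\<in>{1..i}. arr L mem (10 + g) p = ?b p)"
    for i mem and x y :: nat
  have loop: "runs m n (For (sweep_body g)) s'
      (\<lambda>s'. fst s' 0 = L \<and> fst s' 1 = n \<and> I n (snd s') (fst s' 6) (fst s' 7))"
    if s': "fst s' 0 = L \<and> fst s' 1 = n \<and> I 0 (snd s') (fst s' 6) (fst s' 7)" for s'
  proof (rule runs_For)
    fix i and r mem :: "nat \<Rightarrow> nat"
    assume i: "i < n" and r: "r 0 = L" "r 1 = n" "r 2 = i" and I: "I i mem (r 6) (r 7)"
    have A': "arr L mem (6 + g) = A (6 + g)" "arr L mem (8 + g) = A (8 + g)"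
      using I g unfolding I_def frame_def by simp_all
    have "?b (0 + Suc i) \<le> ?b 0 + Suc i" by (rule block_add)
    then have b: "?b (Suc i) < m" using i nm by simp
    have I': "I (Suc i) (aset L (10 + g) (Suc i) (?b (Suc i)) mem) (?b (Suc i)) (of_bool (?f (Suc i)))"
      using I g by (auto simp: I_def le_Suc_eq simp del: block_simps)
    show "wp m (sweep_body g) (\<lambda>s'. fst s' 0 = L \<and> fst s' 1 = n \<and> fst s' 2 = i \<and>
        I (Suc i) (snd s') (fst s' 6) (fst s' 7)) (r, mem)"
    proof -
      have 67: "r 6 = ?b i" "r 7 = of_bool (?f i)" using I by (simp_all add: I_def)
      show ?thesis
        using I' b r A' A[of "Suc i"] nm 67 unfolding sweep_body_def Let_def
        by (cases "Suc i \<in> S g ` K"; cases "Suc i \<in> E g ` K"; cases "?f i") simp_all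
    qed
  qed (use s' nm in auto)
  have "wp m (Assign 6 (Const 0)) (wp m (Assign 7 (Const 1)) (\<lambda>s'. fst s' 0 = L \<and> fst s' 1 = n \<and> I 0 (snd s') (fst s' 6) (fst s' 7))) s"
    using s nm by (simp add: I_def frame_def)
  then have "runs m n (sweep_loop g) s
      (\<lambda>s'. fst s' 0 = L \<and> fst s' 1 = n \<and> I n (snd s') (fst s' 6) (fst s' 7))"
    unfolding sweep_loop_def
    by (rule runs_SeqI[OF runs_wp]) (rule runs_SeqI[OF runs_wp], assumption, rule loop)
  then show ?thesis by (rule runs_conseq) (simp add: I_def squeeze_def)
qed

definition out_list :: "nat set \<Rightarrow> nat \<Rightarrow> nat \<Rightarrow> nat list" where
  "out_list K g i = concat (map (\<lambda>v. [v, squeeze K (S g) (E g) (S g v), squeeze K (S g) (E g) (E g v)])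
     (filter (\<lambda>v. v \<in> K) (map (vv g) [0..<i])))"

lemma out_list_Suc: "out_list K g (Suc i) = out_list K g i @ (if vv g i \<in> K then
    [vv g i, squeeze K (S g) (E g) (S g (vv g i)), squeeze K (S g) (E g) (E g (vv g i))] else [])"
  by (simp add: out_list_def)

lemma length_out_list: "length (out_list K g i) = 3 * length (filter (\<lambda>v. v \<in> K) (map (vv g) [0..<i]))"
  by (induction i) (simp_all add: out_list_Suc, simp add: out_list_def)

lemma length_out_list_le: "length (out_list K g i) \<le> 3 * i"
  using length_filter_le[of "\<lambda>v. v \<in> K" "map (vv g) [0..<i]"] by (simp add: length_out_list)

text \<open>\<open>pre\<close> is what an earlier pass has written. It is no longer than the lists
  read before, so the write position never overtakes the read position and unread triples
  survive.\<close>

lemma run_output: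
  assumes g: "g < 2" and s: "fst s 0 = L" "fst s 1 = n" "frame {} A (snd s)" "filled (snd s)"
    and mem: "\<And>a. 2 + 3 * (g * n) \<le> a \<Longrightarrow> a < L \<Longrightarrow> snd s a = xs ! a"
    and hd: "snd s 0 = c0" "snd s 1 = c1"
    and pre: "fst s 6 = 2 + length pre" "map (snd s) [2..<2 + length pre] = pre" "length pre \<le> 3 * (g * n)"
    and K: "\<And>v. v \<in> V \<Longrightarrow> A 5 (key 1 v) = v + 1 \<longleftrightarrow> v \<in> K"
    and A: "\<And>p. p \<in> {1..n} \<Longrightarrow> A (10 + g) p = squeeze K (S g) (E g) p"
  shows "runs m n (For (output_body g)) s (\<lambda>s'. fst s' 0 = L \<and> fst s' 1 = n \<and>
    frame {} A (snd s') \<and> filled (snd s') \<and>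
    (\<forall>a. 2 + 3 * (n + g * n) \<le> a \<and> a < L \<longrightarrow> snd s' a = xs ! a) \<and> snd s' 0 = c0 \<and> snd s' 1 = c1 \<and>
    fst s' 6 = 2 + length (pre @ out_list K g n) \<and>
    map (snd s') [2..<2 + length (pre @ out_list K g n)] = pre @ out_list K g n)"
proof -
  let ?o = "\<lambda>i. pre @ out_list K g i"
  define I where "I i mem x y \<longleftrightarrow> frame {} A mem \<and> filled mem \<and>
    (\<forall>a. 2 + 3 * (i + g * n) \<le> a \<and> a < L \<longrightarrow> mem a = xs ! a) \<and> mem 0 = c0 \<and> mem 1 = c1 \<and>
    x = 2 + length (?o i) \<and> map mem [2..<2 + length (?o i)] = ?o i" for i mem and x y :: nat
  have "runs m n (For (output_body g)) s
      (\<lambda>s'. fst s' 0 = L \<and> fst s' 1 = n \<and> I n (snd s') (fst s' 6) (fst s' 7))"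
  proof (rule runs_For)
    show "I 0 (snd s) (fst s 6) (fst s 7)" using s mem hd pre by (simp add: I_def out_list_def)
    fix i and r mem :: "nat \<Rightarrow> nat"
    assume i: "i < n" and r: "r 0 = L" "r 1 = n" "r 2 = i" and I: "I i mem (r 6) (r 7)"
    let ?v = "vv g i"
    let ?r = "r(3 := ?v, 4 := S g ?v, 5 := E g ?v)"
    let ?F = "squeeze K (S g) (E g)"
    have V: "?v \<in> V" by (rule vvV[OF g i])
    have A5: "arr L mem 5 = A 5" "arr L mem (10 + g) = A (10 + g)"
      using I g unfolding I_def frame_def by simp_all
    have F: "arr L mem (10 + g) (S g ?v) = ?F (S g ?v)" "arr L mem (10 + g) (E g ?v) = ?F (E g ?v)"
      using A5 A S[OF g V] E[OF g V] by simp_all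
    have Fm: "?F p < m" if "p \<le> n" for p
      using block_add[of "\<lambda>p. p \<in> S g ` K" "\<lambda>p. p \<in> E g ` K" 0 p] that nm unfolding squeeze_def by simp
    have FSE: "?F (S g ?v) < m" "?F (E g ?v) < m"
      using Fm S[OF g V] E[OF g V] by auto
    have bK: "rval (?r, mem) (not_champion 1) = 0 \<longleftrightarrow> ?v \<in> K"
      using rval_not_champion[of 1 mem ?r] I r V K[OF V] A5 by (simp add: I_def)
    define x where "x = r 6"
    have x: "x = 2 + length (?o i)" using I by (simp add: I_def x_def)
    then have x_le: "x \<le> 2 + 3 * (i + g * n)"
      using length_out_list_le[of K g i] pre(3) by simp
    have "g = 0 \<or> g = 1" using g by auto
    then have lt: "x + 3 \<le> L" "2 + 3 * (i + g * n) + 3 \<le> L" using x_le i L by auto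
    show "wp m (output_body g) (\<lambda>s'. fst s' 0 = L \<and> fst s' 1 = n \<and> fst s' 2 = i \<and>
        I (Suc i) (snd s') (fst s' 6) (fst s' 7)) (r, mem)"
      unfolding output_body_def
    proof (rule wp_load[OF g i r(2,3)])
      show "mem a = xs ! a" if "2 + 3 * (i + g * n) \<le> a" "a < L" for a
        using I that by (simp add: I_def)
      show "wp m (IfNZ (not_champion 1) Skip
          (Seq (Store (Reg 6) (Reg 3))
          (Seq (Store (Add (Reg 6) (Const 1)) (Arr (10 + g) (Reg 4)))
          (Seq (Store (Add (Reg 6) (Const 2)) (Arr (10 + g) (Reg 5)))
            (Assign 6 (Add (Reg 6) (Const 3)))))))
         (\<lambda>s'. fst s' 0 = L \<and> fst s' 1 = n \<and> fst s' 2 = i \<and> I (Suc i) (snd s') (fst s' 6) (fst s' 7))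
         (?r, mem)"
      proof (cases "?v \<in> K")
        case True
        let ?mem = "mem(x := ?v, x + 1 := ?F (S g ?v), x + 2 := ?F (E g ?v))"
        have o: "?o (Suc i) = ?o i @ [?v, ?F (S g ?v), ?F (E g ?v)]"
          using True by (simp add: out_list_Suc)
        have "2 + length (?o (Suc i)) = Suc (Suc (Suc x))" unfolding o x by simp
        then have upt: "[2..<2 + length (?o (Suc i))] = [2..<x] @ [x, x + 1, x + 2]"
          using x by (simp only: upt_Suc) simp
        have "map ?mem [2..<2 + length (?o (Suc i))] = map mem [2..<x] @ [?v, ?F (S g ?v), ?F (E g ?v)]"
          unfolding upt by simp
        also have "map mem [2..<x] = ?o i" using I x by (simp add: I_def)
        finally have 1: "map ?mem [2..<2 + length (?o (Suc i))] = ?o (Suc i)" by (simp only: o)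
        have 2: "arr L ?mem = arr L mem" using lt by simp
        have "I (Suc i) ?mem (x + 3) (r 7)"
          unfolding I_def
        proof (intro conjI)
          show "frame {} A ?mem" using I 2 by (simp add: I_def frame_def)
          show "filled ?mem" using I 2 by (simp add: I_def filled_def)
          have "?mem a = mem a" if "a < x \<or> x + 2 < a" for a using that by auto
          then show "\<forall>a. 2 + 3 * (Suc i + g * n) \<le> a \<and> a < L \<longrightarrow> ?mem a = xs ! a"
            "?mem 0 = c0" "?mem 1 = c1"
            using I x x_le by (simp_all add: I_def)
          show "x + 3 = 2 + length (?o (Suc i))" unfolding o x by simp
        qed (rule 1)
        moreover have "?v < m" using Vm[OF V] by simp
        moreover have "x + 3 < m" "L < m" using lt Lm by auto
        ultimately show ?thesis
          using True bK F FSE r lt by (simp add: x_def[symmetric])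
      next
        case False
        then have "?o (Suc i) = ?o i" by (simp add: out_list_Suc)
        then have "I (Suc i) mem (r 6) (r 7)" using I by (simp add: I_def)
        then show ?thesis using False bK r by simp
      qed
    qed
  qed (use s nm in auto)
  then show ?thesis by (rule runs_conseq) (simp add: I_def)
qed

section \<open>Domination by the surviving vertices\<close>

definition good :: "nat set \<Rightarrow> bool" where
  "good K \<longleftrightarrow> K \<subseteq> V \<and> (\<forall>v\<in>V. \<exists>u\<in>K. \<forall>g<2. S g v \<le> S g u \<and> E g u \<le> E g v) \<and>
     inj_on (key 0) K \<and> inj_on (key 1) K"

text \<open>The first clause of \<open>champions\<close> identifies the holder, the second places it
  no earlier than \<open>v\<close>, and sortedness turns this into a start that is no
  smaller.\<close>

lemma championsD:
  assumes t: "champions g C n t" and g: "g < 2" and C: "C \<subseteq> V" "v \<in> C"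
  shows "\<exists>u\<in>C. t (key g u) = u + 1 \<and> key g u = key g v \<and> S g v \<le> S g u"
proof -
  obtain j where j: "j < n" "vv g j = v" using Vvv[OF g] C by blast
  then obtain j' where j': "j' < n" "j \<le> j'" "t (key g v) = vv g j' + 1"
    using t C unfolding champions_def by blast
  then have "t (key g v) \<noteq> 0" by simp
  then obtain i where i: "vv g i \<in> C" "t (key g v) = vv g i + 1" "key g (vv g i) = key g v"
    using t unfolding champions_def by blast
  have "vv g i = vv g j'" using i j' by simp
  then have "S g v \<le> S g (vv g i)" using mono[OF g j'(2,1)] j by simp
  then show ?thesis using i by (intro bexI[of _ "vv g i"]) simp_all
qed

text \<open>
  A vertex is dominated by the champion \<open>u\<close> for its first key, as entries with larger start points
  come later and overwrite. The champion for the second key of \<open>u\<close> in turn dominates \<open>u\<close>.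
\<close>

lemma good_champions:
  assumes t0: "champions 0 V n t0"
    and t1: "champions 1 {v \<in> V. t0 (key 0 v) = v + 1} n t1"
  shows "good {v \<in> V. t1 (key 1 v) = v + 1}"
proof -
  let ?C = "{v \<in> V. t0 (key 0 v) = v + 1}" and ?K = "{v \<in> V. t1 (key 1 v) = v + 1}"
  have KC: "?K \<subseteq> ?C"
  proof
    fix v assume "v \<in> ?K"
    then have v: "t1 (key 1 v) = v + 1" by simp
    then have "t1 (key 1 v) \<noteq> 0" by simp
    then obtain j where j: "vv 1 j \<in> ?C" "t1 (key 1 v) = vv 1 j + 1"
      using t1 unfolding champions_def by blast
    then have "vv 1 j = v" using v by simp
    then show "v \<in> ?C" using j(1) by simp
  qed
  have "\<exists>u\<in>?K. \<forall>g<2. S g v \<le> S g u \<and> E g u \<le> E g v" if v: "v \<in> V" for v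
  proof -
    obtain u where u: "u \<in> V" "t0 (key 0 u) = u + 1" "key 0 u = key 0 v" "S 0 v \<le> S 0 u"
      using championsD[OF t0 _ subset_refl v] by auto
    then have "u \<in> ?C" by simp
    then obtain w where w: "w \<in> ?C" "t1 (key 1 w) = w + 1" "key 1 w = key 1 u" "S 1 u \<le> S 1 w"
      using championsD[OF t1, of u] by auto
    then have wV: "w \<in> V" by simp
    note 1 = key_eqD[OF u(3) _ u(1) v, simplified]
    note 2 = key_eqD[OF w(3) _ wV u(1), simplified]
    have "S 0 v \<le> S 0 w \<and> E 0 w \<le> E 0 v" "S 1 v \<le> S 1 w \<and> E 1 w \<le> E 1 v"
      using 1 2 u(4) w(4) by simp_all
    then have "\<forall>g<2. S g v \<le> S g w \<and> E g w \<le> E g v"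
      by (auto dest!: less_2_cases)
    moreover have "w \<in> ?K" using wV w(2) by simp
    ultimately show ?thesis by blast
  qed
  \<comment> \<open>The table entry minus one recovers a champion from its key.\<close>
  moreover have "inj_on (key 0) ?C"
    by (rule inj_on_inverseI[where g = "\<lambda>x. t0 x - 1"]) simp
  moreover have "inj_on (key 1) ?K"
    by (rule inj_on_inverseI[where g = "\<lambda>x. t1 x - 1"]) simp
  ultimately show ?thesis
    using KC unfolding good_def by (auto intro: inj_on_subset)
qed

section \<open>Composition of the phases\<close>

definition zero :: "nat set \<Rightarrow> state \<Rightarrow> bool" where
  "zero J s \<longleftrightarrow> (\<forall>j\<in>J. arr L (snd s) j = (\<lambda>_. 0))"

definition ready :: "state \<Rightarrow> bool" where
  "ready s \<longleftrightarrow> fst s 0 = L \<and> fst s 1 = n \<and> intact (snd s) \<and> filled (snd s)"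

definition chosen :: "nat set \<Rightarrow> state \<Rightarrow> bool" where
  "chosen K s \<longleftrightarrow> (\<forall>v\<in>V. arr L (snd s) 5 (key 1 v) = v + 1 \<longleftrightarrow> v \<in> K)"

definition marked :: "nat set \<Rightarrow> nat \<Rightarrow> state \<Rightarrow> bool" where
  "marked K g s \<longleftrightarrow> (\<forall>p. arr L (snd s) (6 + g) p \<noteq> 0 \<longleftrightarrow> p \<in> S g ` K) \<and>
     (\<forall>p. arr L (snd s) (8 + g) p \<noteq> 0 \<longleftrightarrow> p \<in> E g ` K)"

definition swept :: "nat set \<Rightarrow> nat \<Rightarrow> state \<Rightarrow> bool" where
  "swept K g s \<longleftrightarrow> (\<forall>p\<in>{1..n}. arr L (snd s) (10 + g) p = squeeze K (S g) (E g) p)"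

lemma frame_refl: "frame J (arr L mem) mem"
  by (simp add: frame_def)

text \<open>\<open>q\<close> stands for the rest of the program: each lemma on a phase hands over
  just the facts that later phases rely on.\<close>

lemma run_fill_both:
  assumes s: "fst s 0 = L" "fst s 1 = n" "intact (snd s)" "zero {0..<12} s"
    and q: "\<And>s'. ready s' \<Longrightarrow> zero {4..<12} s' \<Longrightarrow> runs m n q s' Q"
  shows "runs m n (Seq (For (fill_body 0)) (Seq (For (fill_body 1)) q)) s Q"
proof (rule runs_SeqI[OF run_fill[OF _ s(1-3), where J = "{}" and A = "\<lambda>_ _. 0"]])
  show "frame {} (\<lambda>_ _. 0) (snd s)" using s(4) by (simp add: frame_def zero_def)
  fix s1 :: state
  assume s1: "fst s1 0 = L \<and> fst s1 1 = n \<and> intact (snd s1) \<and> frame ({} \<union> {0, 2 + 0}) (\<lambda>_ _. 0) (snd s1) \<and>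
    (\<forall>h<2. h \<noteq> 0 \<longrightarrow> arr L (snd s1) h = arr L (snd s) h \<and> arr L (snd s1) (2 + h) = arr L (snd s) (2 + h)) \<and>
    (\<forall>v\<in>V. arr L (snd s1) 0 v = S 0 v \<and> arr L (snd s1) (2 + 0) v = E 0 v)"
  show "runs m n (Seq (For (fill_body 1)) q) s1 Q"
  proof (rule runs_SeqI[OF run_fill[where J = "{0, 2}" and A = "\<lambda>_ _. 0"]])
    fix s2 :: state
    assume s2: "fst s2 0 = L \<and> fst s2 1 = n \<and> intact (snd s2) \<and>
      frame ({0, 2} \<union> {1, 2 + 1}) (\<lambda>_ _. 0) (snd s2) \<and>
      (\<forall>h<2. h \<noteq> 1 \<longrightarrow> arr L (snd s2) h = arr L (snd s1) h \<and> arr L (snd s2) (2 + h) = arr L (snd s1) (2 + h)) \<and>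
      (\<forall>v\<in>V. arr L (snd s2) 1 v = S 1 v \<and> arr L (snd s2) (2 + 1) v = E 1 v)"
    have "(0::nat) < 2" "(0::nat) \<noteq> 1" by simp_all
    then have "arr L (snd s2) 0 = arr L (snd s1) 0 \<and> arr L (snd s2) (2 + 0) = arr L (snd s1) (2 + 0)"
      using s2 by blast
    then have "filled (snd s2)"
      using s1 s2 unfolding filled_def all_less_2_iff by simp
    then show "runs m n q s2 Q"
      using s2 by (intro q) (auto simp: ready_def zero_def frame_def)
  qed (use s1 in auto)
qed simp

text \<open>The rest has to work for every \<open>good\<close> set, as the surviving set is
  determined only by the run.\<close>

lemma run_champions:
  assumes s: "ready s" "zero {4..<12} s"
    and q: "\<And>s' K. ready s' \<Longrightarrow> zero {6..<12} s' \<Longrightarrow> good K \<Longrightarrow> chosen K s' \<Longrightarrow> runs m n q s' Q"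
  shows "runs m n (Seq (For (champion_body 0 (Const 0))) (Seq (For (champion_body 1 (not_champion 0))) q)) s Q"
proof (rule runs_SeqI[OF run_champion[where A = "arr L (snd s)" and C = V]])
  fix s1 :: state
  assume s1: "fst s1 0 = L \<and> fst s1 1 = n \<and> intact (snd s1) \<and> filled (snd s1) \<and>
    frame {4 + 0} (arr L (snd s)) (snd s1) \<and> champions 0 V n (arr L (snd s1) (4 + 0))"
  let ?C = "{v \<in> V. arr L (snd s1) 4 (key 0 v) = v + 1}"
  have z1: "zero {5..<12} s1" using s1 s(2) by (simp add: zero_def frame_def)
  show "runs m n (Seq (For (champion_body 1 (not_champion 0))) q) s1 Q"
  proof (rule runs_SeqI[OF run_champion[where A = "arr L (snd s1)" and C = ?C]])
    show "rval (r, mem) (not_champion 0) = 0 \<longleftrightarrow> r 3 \<in> ?C"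
      if "r 0 = L" "r 3 \<in> V" "filled mem" "frame {4 + 1} (arr L (snd s1)) mem" for r mem
    proof -
      have "arr L mem 4 = arr L (snd s1) 4" using that(4) by (simp add: frame_def)
      then show ?thesis using rval_not_champion[of 0 mem r] that by simp
    qed
    show "arr L (snd s1) (4 + 1) = (\<lambda>_. 0)" using z1 by (simp add: zero_def)
    fix s2 :: state
    assume s2: "fst s2 0 = L \<and> fst s2 1 = n \<and> intact (snd s2) \<and> filled (snd s2) \<and>
      frame {4 + 1} (arr L (snd s1)) (snd s2) \<and> champions 1 ?C n (arr L (snd s2) (4 + 1))"
    have "good {v \<in> V. arr L (snd s2) 5 (key 1 v) = v + 1}"
      using s1 s2 by (intro good_champions[of "arr L (snd s1) 4"]) simp_all
    moreover have "chosen {v \<in> V. arr L (snd s2) 5 (key 1 v) = v + 1} s2"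
      by (simp add: chosen_def)
    moreover have "zero {6..<12} s2" using s2 z1 by (simp add: zero_def frame_def)
    moreover have "ready s2" using s2 by (simp add: ready_def)
    ultimately show "runs m n q s2 Q" using q by blast
  qed (use s1 frame_refl in auto)
qed (use s frame_refl in \<open>auto simp: ready_def zero_def\<close>)

lemma run_mark_both:
  assumes s: "ready s" "zero {6..<12} s" and K: "K \<subseteq> V" "chosen K s"
    and q: "\<And>s'. ready s' \<Longrightarrow> chosen K s' \<Longrightarrow> marked K 0 s' \<Longrightarrow> marked K 1 s' \<Longrightarrow> runs m n q s' Q"
  shows "runs m n (Seq (For (mark_body 0)) (Seq (For (mark_body 1)) q)) s Q"
proof (rule runs_SeqI[OF run_mark[where A = "arr L (snd s)" and K = K]])
  fix s1 :: state
  assume s1: "fst s1 0 = L \<and> fst s1 1 = n \<and> intact (snd s1) \<and> filled (snd s1) \<and>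
    frame {6 + 0, 8 + 0} (arr L (snd s)) (snd s1) \<and>
    (\<forall>p. arr L (snd s1) (6 + 0) p \<noteq> 0 \<longleftrightarrow> p \<in> S 0 ` K) \<and>
    (\<forall>p. arr L (snd s1) (8 + 0) p \<noteq> 0 \<longleftrightarrow> p \<in> E 0 ` K)"
  have c1: "chosen K s1" and z1: "zero {7, 9} s1" and m1: "marked K 0 s1"
    using s1 K s(2) by (simp_all add: chosen_def frame_def zero_def marked_def)
  show "runs m n (Seq (For (mark_body 1)) q) s1 Q"
  proof (rule runs_SeqI[OF run_mark[where A = "arr L (snd s1)" and K = K]])
    fix s2 :: state
    assume s2: "fst s2 0 = L \<and> fst s2 1 = n \<and> intact (snd s2) \<and> filled (snd s2) \<and>
      frame {6 + 1, 8 + 1} (arr L (snd s1)) (snd s2) \<and>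
      (\<forall>p. arr L (snd s2) (6 + 1) p \<noteq> 0 \<longleftrightarrow> p \<in> S 1 ` K) \<and>
      (\<forall>p. arr L (snd s2) (8 + 1) p \<noteq> 0 \<longleftrightarrow> p \<in> E 1 ` K)"
    have "chosen K s2" "marked K 0 s2" using s2 c1 m1 by (simp_all add: chosen_def frame_def marked_def)
    moreover have "marked K 1 s2" using s2 unfolding marked_def by blast
    ultimately show "runs m n q s2 Q" using q s2 by (simp add: ready_def)
  qed (use s1 frame_refl c1 z1 K in \<open>auto simp: chosen_def zero_def\<close>)
qed (use s frame_refl K in \<open>auto simp: ready_def zero_def chosen_def\<close>)

lemma run_sweep_both:
  assumes s: "ready s" "chosen K s" "marked K 0 s" "marked K 1 s"
    and q: "\<And>s'. ready s' \<Longrightarrow> chosen K s' \<Longrightarrow> swept K 0 s' \<Longrightarrow> swept K 1 s' \<Longrightarrow> runs m n q s' Q"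
  shows "runs m n (Seq (sweep_loop 0) (Seq (sweep_loop 1) q)) s Q"
proof (rule runs_SeqI[OF run_sweep[where A = "arr L (snd s)" and K = K]])
  fix s1 :: state
  assume s1: "fst s1 0 = L \<and> fst s1 1 = n \<and> intact (snd s1) \<and> filled (snd s1) \<and>
    frame {10 + 0} (arr L (snd s)) (snd s1) \<and>
    (\<forall>p\<in>{1..n}. arr L (snd s1) (10 + 0) p = squeeze K (S 0) (E 0) p)"
  have c1: "chosen K s1" and m1: "marked K 1 s1" and w1: "swept K 0 s1"
    using s1 s by (simp_all add: chosen_def frame_def marked_def swept_def)
  show "runs m n (Seq (sweep_loop 1) q) s1 Q"
  proof (rule runs_SeqI[OF run_sweep[where A = "arr L (snd s1)" and K = K]])
    fix s2 :: state
    assume s2: "fst s2 0 = L \<and> fst s2 1 = n \<and> intact (snd s2) \<and> filled (snd s2) \<and>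
      frame {10 + 1} (arr L (snd s1)) (snd s2) \<and>
      (\<forall>p\<in>{1..n}. arr L (snd s2) (10 + 1) p = squeeze K (S 1) (E 1) p)"
    have "chosen K s2" "swept K 0 s2" using s2 c1 w1 by (simp_all add: chosen_def frame_def swept_def)
    moreover have "swept K 1 s2" using s2 unfolding swept_def by blast
    ultimately show "runs m n q s2 Q" using q s2 by (simp add: ready_def)
  qed (use s1 frame_refl m1 in \<open>simp_all add: marked_def\<close>)
qed (use s frame_refl in \<open>simp_all add: ready_def marked_def\<close>)

lemma run_output_both:
  assumes s: "ready s" "chosen K s" "swept K 0 s" "swept K 1 s"
  shows "runs m n (Seq (Assign 6 (Const 2)) (Seq (For (output_body 0))
      (Seq (Store (Const 1) (Div (Sub (Reg 6) (Const 2)) (Const 3)))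
      (Seq (For (output_body 1)) (Assign 0 (Reg 6)))))) s
    (\<lambda>s'. output_of s' = xs ! 0 # length (out_list K 0 n) div 3 # out_list K 0 n @ out_list K 1 n)"
    (is "runs m n (Seq _ ?q) s ?Q")
proof (rule runs_SeqI[OF runs_wp])
  have L2: "2 \<le> L" "L < m" using L Lm by simp_all
  have small: "length (out_list K g n) \<le> 3 * n" for g by (rule length_out_list_le)
  show "wp m (Assign 6 (Const 2)) (\<lambda>s'. s' = ((fst s)(6 := 2), snd s)) s" using L2 by simp
  fix s0 :: state assume s0: "s0 = ((fst s)(6 := 2), snd s)"
  show "runs m n ?q s0 ?Q"
  proof (rule runs_SeqI[OF run_output[where A = "arr L (snd s)" and K = K and pre = "[]"
          and ?c0.0 = "xs ! 0" and ?c1.0 = "xs ! 1"]])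
    fix s1 :: state
    assume s1: "fst s1 0 = L \<and> fst s1 1 = n \<and> frame {} (arr L (snd s)) (snd s1) \<and> filled (snd s1) \<and>
      (\<forall>a. 2 + 3 * (n + 0 * n) \<le> a \<and> a < L \<longrightarrow> snd s1 a = xs ! a) \<and> snd s1 0 = xs ! 0 \<and> snd s1 1 = xs ! 1 \<and>
      fst s1 6 = 2 + length ([] @ out_list K 0 n) \<and>
      map (snd s1) [2..<2 + length ([] @ out_list K 0 n)] = [] @ out_list K 0 n"
    let ?k = "length (out_list K 0 n) div 3"
    let ?s2 = "(fst s1, (snd s1)(1 := ?k))"
    show "runs m n (Seq (Store (Const 1) (Div (Sub (Reg 6) (Const 2)) (Const 3)))
      (Seq (For (output_body 1)) (Assign 0 (Reg 6)))) s1 ?Q"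
    proof (rule runs_SeqI[OF runs_wp[where Q = "\<lambda>s'. s' = ?s2"]])
      show "wp m (Store (Const 1) (Div (Sub (Reg 6) (Const 2)) (Const 3))) (\<lambda>s'. s' = ?s2) s1"
        using s1 small[of 0] nm by simp
      fix s2 :: state assume s2: "s2 = ?s2"
      have ar2: "arr L (snd s2) = arr L (snd s1)" using s2 L2 by simp
      show "runs m n (Seq (For (output_body 1)) (Assign 0 (Reg 6))) s2 ?Q"
      proof (rule runs_SeqI[OF run_output[where A = "arr L (snd s)" and K = K and pre = "out_list K 0 n"
            and ?c0.0 = "xs ! 0" and ?c1.0 = ?k]])
        show "frame {} (arr L (snd s)) (snd s2)" using s1 ar2 by (simp add: frame_def)
        show "filled (snd s2)" using s1 ar2 by (simp add: filled_def)
        show "snd s2 a = xs ! a" if "2 + 3 * (1 * n) \<le> a" "a < L" for a using s1 s2 that by simp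
        have "map (snd s2) [2..<2 + length (out_list K 0 n)] = map (snd s1) [2..<2 + length (out_list K 0 n)]"
          using s2 by (intro map_cong refl) auto
        then show "map (snd s2) [2..<2 + length (out_list K 0 n)] = out_list K 0 n"
          using s1 by (simp only: append_Nil)
        show "arr L (snd s) (10 + 1) p = squeeze K (S 1) (E 1) p" if "p \<in> {1..n}" for p
          using s(4) that unfolding swept_def by blast
        fix s3 :: state
        let ?o = "out_list K 0 n @ out_list K 1 n"
        assume s3: "fst s3 0 = L \<and> fst s3 1 = n \<and> frame {} (arr L (snd s)) (snd s3) \<and> filled (snd s3) \<and>
          (\<forall>a. 2 + 3 * (n + 1 * n) \<le> a \<and> a < L \<longrightarrow> snd s3 a = xs ! a) \<and> snd s3 0 = xs ! 0 \<and> snd s3 1 = ?k \<and>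
          fst s3 6 = 2 + length ?o \<and> map (snd s3) [2..<2 + length ?o] = ?o"
        have "[0..<2 + length ?o] = [0, 1] @ [2..<2 + length ?o]"
          by (simp add: upt_conv_Cons numeral_2_eq_2 del: upt_Suc)
        then have "map (snd s3) [0..<2 + length ?o] = xs ! 0 # ?k # ?o"
          using s3 by (simp only: map_append) simp
        \<comment> \<open>The output length is stored in register \<open>0\<close>, so it has to be
          below \<open>m\<close>; it is at most the input length.\<close>
        moreover have "2 + length ?o < m" using small[of 0] small[of 1] L Lm by simp
        ultimately show "runs m n (Assign 0 (Reg 6)) s3 ?Q"
          using s3 by (intro runs_wp) (simp add: output_of_def del: upt_Suc)
      qed (use s1 s2 s small in \<open>auto simp: chosen_def\<close>)
    qed
  qed (use s s0 frame_refl L2 in \<open>auto simp: ready_def chosen_def swept_def intact_def\<close>)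
qed

lemma run_kernelize:
  assumes s: "fst s 0 = L" "intact (snd s)" "\<And>a. L \<le> a \<Longrightarrow> snd s a = 0"
  shows "runs m n kernelize s (\<lambda>s'. \<exists>K. good K \<and>
    output_of s' = xs ! 0 # length (out_list K 0 n) div 3 # out_list K 0 n @ out_list K 1 n)"
  unfolding kernelize_def
proof (rule runs_SeqI[OF runs_wp[where Q = "\<lambda>s'. s' = ((fst s)(1 := n), snd s)"]], goal_cases)
  case 1
  have "snd s 1 = n" using s(2) L xs1 unfolding intact_def by simp
  then show "wp m (Assign 1 (Mem (Const 1))) (\<lambda>s'. s' = ((fst s)(1 := n), snd s)) s"
    using nm by simp
next
  case (2 s0)
  show ?case
  proof (rule run_fill_both, goal_cases)
    case 4
    show ?case using s(3) 2 by (auto simp: zero_def arr_def)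
  next
    case (5 s1)
    show ?case
    proof (rule run_champions[OF 5], goal_cases)
      case (1 s2 K)
      then have "K \<subseteq> V" by (simp add: good_def)
      show ?case
      proof (rule run_mark_both[OF 1(1,2) \<open>K \<subseteq> V\<close> 1(4)], goal_cases)
        case (1 s3)
        show ?case
          by (rule run_sweep_both[OF 1], rule runs_conseq[OF run_output_both], assumption+)
            (use \<open>good K\<close> in blast)
      qed
    qed
  qed (use s 2 in auto)
qed

end

section \<open>Encoded instances as inputs of the program\<close>

lemma encode_rep_simps [simp]:
  "encode_rep [] = []" "encode_rep (x # R) = [fst x, fst (snd x), snd (snd x)] @ encode_rep R"
  by (simp_all add: encode_rep_def case_prod_unfold)

lemma length_encode_rep [simp]: "length (encode_rep R) = 3 * length R"
  by (induction R) simp_all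

lemma nth_encode_rep:
  assumes "i < length R"
  shows "encode_rep R ! (3 * i) = fst (R ! i)" "encode_rep R ! (Suc (3 * i)) = fst (snd (R ! i))"
    "encode_rep R ! (Suc (Suc (3 * i))) = snd (snd (R ! i))"
proof -
  have "encode_rep R ! (3 * i) = fst (R ! i) \<and> encode_rep R ! (Suc (3 * i)) = fst (snd (R ! i)) \<and>
    encode_rep R ! (Suc (Suc (3 * i))) = snd (snd (R ! i))"
    using assms
  proof (induction R arbitrary: i)
    case (Cons x R)
    then show ?case by (cases i) simp_all
  qed simp
  then show "encode_rep R ! (3 * i) = fst (R ! i)" "encode_rep R ! (Suc (3 * i)) = fst (snd (R ! i))"
    "encode_rep R ! (Suc (Suc (3 * i))) = snd (snd (R ! i))" by simp_all
qed

lemma compact_rep_nth: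
  assumes "compact_rep c V E R" "i < length R"
  shows "fst (R ! i) \<in> V" "start_of R (fst (R ! i)) = fst (snd (R ! i))"
    "end_of R (fst (R ! i)) = snd (snd (R ! i))"
proof -
  have d: "distinct (map fst R)" and V: "fst ` set R = V"
    using assms(1) unfolding compact_rep_def by simp_all
  have i: "R ! i \<in> set R" using assms(2) by simp
  then show "fst (R ! i) \<in> V" using V by blast
  have "(fst (R ! i), fst (snd (R ! i)), snd (snd (R ! i))) \<in> set R" using i by simp
  from compact_rep_mem[OF d this]
  show "start_of R (fst (R ! i)) = fst (snd (R ! i))" "end_of R (fst (R ! i)) = snd (snd (R ! i))" .
qed

lemma length_compact_rep: "compact_rep c V E R \<Longrightarrow> length R = card V"
  unfolding compact_rep_def by (metis distinct_card length_map set_map)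

lemma kernel_input_encode:
  fixes V E1 E2 R1 R2 k
  defines "xs \<equiv> encode R1 R2 k" and "R \<equiv> (\<lambda>g::nat. if g = 0 then R1 else R2)"
  assumes G: "union_is_instance V E1 E2"
    and R12: "compact_rep (c_min V E1) V E1 R1" "compact_rep (c_min V E2) V E2 R2"
  shows "kernel_input (2 + length xs + Max (insert 0 (set xs))) (card V) (length xs) xs V
    (\<lambda>g. start_of (R g)) (\<lambda>g. end_of (R g)) (\<lambda>g i. fst (R g ! i))"
proof
  let ?n = "card V"
  define F where "F g = (if g = (0::nat) then E1 else E2)" for g
  have sg: "simple_graph V (F g)" for g
    using G by (auto simp: F_def union_is_instance_def interval_graph_def)
  have R: "compact_rep (c_min V (F g)) V (F g) (R g)" for g using R12 by (simp add: R_def F_def)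
  have len: "length (R g) = ?n" for g by (rule length_compact_rep[OF R])
  have len12: "length R1 = ?n" "length R2 = ?n" using len[of 0] len[of 1] by (simp_all add: R_def)
  have xs: "xs = k # ?n # encode_rep R1 @ encode_rep R2" by (simp add: xs_def encode_def len12)
  show L: "length xs = 2 + 6 * ?n" by (simp add: xs len12)
  show "length xs < 2 + length xs + Max (insert 0 (set xs))" "length xs = length xs" "xs ! 1 = ?n"
    by (simp_all add: xs)
  show ent: "xs ! (2 + 3 * (i + g * ?n)) = fst (R g ! i) \<and>
      xs ! (3 + 3 * (i + g * ?n)) = start_of (R g) (fst (R g ! i)) \<and>
      xs ! (4 + 3 * (i + g * ?n)) = end_of (R g) (fst (R g ! i))"
    if g: "g < 2" and i: "i < ?n" for g i
  proof -
    have i': "i < length (R g)" using i len by simp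
    note nth = nth_encode_rep[OF i'] compact_rep_nth(2,3)[OF R i']
    have nx: "xs ! (2 + a) = (encode_rep R1 @ encode_rep R2) ! a" for a by (simp add: xs)
    have off: "(encode_rep R1 @ encode_rep R2) ! (a + 3 * (g * ?n)) = encode_rep (R g) ! a" if "a < 3 * ?n" for a
    proof (cases "g = 0")
      case False
      then have "g = 1" using g by simp
      then show ?thesis by (simp add: nth_append len12 R_def)
    qed (use that in \<open>simp add: nth_append len12 R_def\<close>)
    have "xs ! (2 + 3 * (i + g * ?n)) = encode_rep (R g) ! (3 * i)"
      "xs ! (3 + 3 * (i + g * ?n)) = encode_rep (R g) ! (Suc (3 * i))"
      "xs ! (4 + 3 * (i + g * ?n)) = encode_rep (R g) ! (Suc (Suc (3 * i)))"
      using nx[of "3 * i + 3 * (g * ?n)"] off[of "3 * i"]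
        nx[of "Suc (3 * i) + 3 * (g * ?n)"] off[of "Suc (3 * i)"]
        nx[of "Suc (Suc (3 * i)) + 3 * (g * ?n)"] off[of "Suc (Suc (3 * i))"] i
      by (simp_all add: distrib_left eval_nat_numeral)
    then show ?thesis using nth by simp
  qed
  show bij: "bij_betw (\<lambda>i. fst (R g ! i)) {..<?n} V" for g
  proof -
    have d: "distinct (map fst (R g))" and V: "fst ` set (R g) = V"
      using R[of g] unfolding compact_rep_def by simp_all
    have "bij_betw ((!) (map fst (R g))) {..<?n} V"
      using d V len by (intro bij_betw_nth) simp_all
    then show ?thesis
      by (rule bij_betw_cong[THEN iffD1, rotated]) (simp add: len)
  qed
  \<comment> \<open>The key tables store vertices increased by one. Vertices are arbitrary numbers,
    but they occur in the input and are thus at most its largest entry.\<close>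
  show "v + 1 < 2 + length xs + Max (insert 0 (set xs))" if v: "v \<in> V" for v
  proof -
    obtain i where i: "i < ?n" "v = fst (R 0 ! i)"
      using bij[of 0] v unfolding bij_betw_def by blast
    have "v = xs ! (2 + 3 * i)" using ent[of 0 i] i by simp
    moreover have "2 + 3 * i < length xs" using i L by simp
    ultimately have "v \<in> set xs" by (metis nth_mem)
    then have "v \<le> Max (insert 0 (set xs))" by (intro Max_ge) simp_all
    then show ?thesis using L by simp
  qed
  show "1 \<le> start_of (R g) v" "start_of (R g) v \<le> end_of (R g) v" if "v \<in> V" for g v
    using compact_repD[OF R that] by simp_all
  show "end_of (R g) v \<le> ?n" if "v \<in> V" for g v
    using compact_repD(3)[OF R that] c_min_le_card[OF R sg] by (rule le_trans)
  show "start_of (R g) (fst (R g ! i)) \<le> start_of (R g) (fst (R g ! j))" if "i \<le> j" "j < ?n" for g i j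
  proof -
    have "sorted (map (\<lambda>(v, s, e). s) (R g))" using R[of g] unfolding compact_rep_def by simp
    then have "map (\<lambda>(v, s, e). s) (R g) ! i \<le> map (\<lambda>(v, s, e). s) (R g) ! j"
      using that len by (intro sorted_nth_mono) simp_all
    then show ?thesis using that len compact_rep_nth(2)[OF R] by (simp add: case_prod_unfold)
  qed
qed

lemma (in kernel_input) out_list_eq_encode_rep:
  assumes R: "compact_rep c V F R" and SE: "S g = start_of R" "E g = end_of R"
    and v: "\<And>i. i < n \<Longrightarrow> vv g i = fst (R ! i)" "length R = n"
  shows "out_list K g n = encode_rep (reduced K R)"
proof -
  let ?F = "squeeze K (start_of R) (end_of R)"
  let ?f = "\<lambda>v. [v, ?F (start_of R v), ?F (end_of R v)]"
  have d: "distinct (map fst R)" using R unfolding compact_rep_def by simp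
  have "map (vv g) [0..<n] = map fst R" using v by (intro nth_equalityI) simp_all
  then have "out_list K g n = concat (map (\<lambda>x. ?f (fst x)) (filter (\<lambda>x. fst x \<in> K) R))"
    by (simp add: out_list_def SE filter_map comp_def)
  also have "map (\<lambda>x. ?f (fst x)) (filter (\<lambda>x. fst x \<in> K) R) =
      map (\<lambda>(v, s, e). [v, ?F s, ?F e]) (filter (\<lambda>x. fst x \<in> K) R)"
    by (intro map_cong) (auto simp: compact_rep_mem[OF d])
  also have "concat \<dots> = encode_rep (reduced K R)"
    by (simp add: encode_rep_def reduced_def comp_def case_prod_unfold)
  finally show ?thesis .
qed

text \<open>The logarithm is at least \<open>1\<close> from \<open>n = 2\<close> on, so a linear
  time bound suffices; the factor \<open>2\<close> comes from
  \<open>n + 1 \<le> 2 * n\<close>.\<close>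

lemma linear_bigo: "(\<lambda>n. real (c * (n + 1))) \<in> O(\<lambda>n. real n * (log 2 (real n))\<^sup>2)"
proof (rule bigoI[where c = "2 * real c"])
  show "\<forall>\<^sub>F n in sequentially. norm (real (c * (n + 1))) \<le> 2 * real c * norm (real n * (log 2 (real n))\<^sup>2)"
    using eventually_ge_at_top[of 2]
  proof eventually_elim
    case (elim n)
    then have "1 \<le> log 2 (real n)" by simp
    then have "1 \<le> (log 2 (real n))\<^sup>2" by (simp add: power2_eq_square mult_ge1_I)
    then have "real n * 1 \<le> real n * (log 2 (real n))\<^sup>2" by (intro mult_left_mono) simp_all
    moreover have "real (n + 1) \<le> 2 * real n" using elim by simp
    ultimately have "real (n + 1) \<le> 2 * (real n * (log 2 (real n))\<^sup>2)" by linarith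
    then have "real c * real (n + 1) \<le> real c * (2 * (real n * (log 2 (real n))\<^sup>2))"
      by (intro mult_left_mono) simp_all
    then show ?case by (simp add: abs_mult algebra_simps)
  qed
qed

theorem theorem8:
  "\<exists>(p :: com) (d :: nat) (T :: nat \<Rightarrow> real) (f :: nat \<Rightarrow> nat) (g :: nat \<Rightarrow> nat).
     T \<in> O(\<lambda>n. real n * (log 2 (real n))\<^sup>2) \<and>
     (\<forall>V E1 E2 k xs. encodes_instance xs V E1 E2 k \<longrightarrow>
       (\<exists>V' E1' E2' k' ys t.
          computes p d xs t ys \<and> real t \<le> T (card V) \<and>
          encodes_instance ys V' E1' E2' k' \<and>
          (union_is_yes V' E1' E2' k' \<longleftrightarrow> union_is_yes V E1 E2 k) \<and>
          k' \<le> f k \<and> c_all V' E1' E2' \<le> g (c_all V E1 E2) \<and>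
          card V' \<le> (c_all V E1 E2) ^ 3 \<and>
          (proper_interval_graph V E1 \<or> proper_interval_graph V E2 \<longrightarrow>
             card V' \<le> 2 * (c_all V E1 E2)\<^sup>2)))"
proof (rule exI[of _ kernelize], rule exI[of _ "com_degree kernelize"],
    rule exI[of _ "\<lambda>n. real (time_coeff kernelize * (n + 1))"], rule exI[of _ id], rule exI[of _ id],
    intro conjI allI impI linear_bigo)
  fix V E1 E2 k xs
  assume "encodes_instance xs V E1 E2 k"
  then obtain R1 R2 where G: "union_is_instance V E1 E2"
    and R1: "compact_rep (c_min V E1) V E1 R1" and R2: "compact_rep (c_min V E2) V E2 R2"
    and xs: "xs = encode R1 R2 k"
    unfolding encodes_instance_def by blast
  define R where "R = (\<lambda>g::nat. if g = 0 then R1 else R2)"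
  \<comment> \<open>\<open>m\<close> is the base of \<open>word_bound\<close>; the exponent
    \<open>com_degree kernelize\<close> depends on the program only.\<close>
  define m where "m = 2 + length xs + Max (insert 0 (set xs))"
  interpret kernel_input m "card V" "length xs" xs V "\<lambda>g. start_of (R g)" "\<lambda>g. end_of (R g)"
    "\<lambda>g i. fst (R g ! i)"
    unfolding m_def R_def xs by (rule kernel_input_encode[OF G R1 R2])
  have "xs ! a < m" if "a < length xs" for a
  proof -
    have "xs ! a \<le> Max (insert 0 (set xs))" using that by (intro Max_ge) simp_all
    then show ?thesis by (simp add: m_def)
  qed
  then have "below m (initial_state xs)" by (simp add: below_def initial_state_def m_def)
  moreover have "runs m (card V) kernelize (initial_state xs) (\<lambda>s'. \<exists>K. good K \<and>
      output_of s' = xs ! 0 # length (out_list K 0 (card V)) div 3 #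
        out_list K 0 (card V) @ out_list K 1 (card V))"
    by (rule run_kernelize) (simp_all add: initial_state_def intact_def)
  ultimately obtain t s' K where ex: "exec (m ^ com_degree kernelize) kernelize (initial_state xs) t s'"
    and t: "t \<le> time_coeff kernelize * (card V + 1)" and K: "good K"
    and out: "output_of s' = xs ! 0 # length (out_list K 0 (card V)) div 3 #
        out_list K 0 (card V) @ out_list K 1 (card V)"
    unfolding runs_def by blast
  let ?ys = "encode (reduced K R1) (reduced K R2) k"
  have "out_list K 0 (card V) = encode_rep (reduced K R1)"
    by (rule out_list_eq_encode_rep[OF R1]) (simp_all add: R_def length_compact_rep[OF R1])
  moreover have "out_list K 1 (card V) = encode_rep (reduced K R2)"
    by (rule out_list_eq_encode_rep[OF R2]) (simp_all add: R_def length_compact_rep[OF R2])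
  ultimately have "output_of s' = ?ys" using out by (simp add: encode_def xs)
  then have comp: "computes kernelize (com_degree kernelize) xs t ?ys"
    using ex unfolding computes_def word_bound_def m_def by blast
  have KV: "K \<subseteq> V" using K by (simp add: good_def)
  have dom: "\<exists>u\<in>K. start_of R1 v \<le> start_of R1 u \<and> end_of R1 u \<le> end_of R1 v \<and>
      start_of R2 v \<le> start_of R2 u \<and> end_of R2 u \<le> end_of R2 v" if "v \<in> V" for v
  proof -
    have "\<forall>v\<in>V. \<exists>u\<in>K. \<forall>g<2. start_of (R g) v \<le> start_of (R g) u \<and> end_of (R g) u \<le> end_of (R g) v"
      using K unfolding good_def by (elim conjE)
    from bspec[OF this that] show ?thesis unfolding all_less_2_iff by (simp add: R_def)
  qed
  have inj0: "inj_on (\<lambda>v. (end_of R1 v, start_of R2 v, end_of R2 v)) K"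
  proof (rule inj_onI)
    fix u v
    assume uv: "u \<in> K" "v \<in> K" "(end_of R1 u, start_of R2 u, end_of R2 u) = (end_of R1 v, start_of R2 v, end_of R2 v)"
    then have "key 0 u = key 0 v" unfolding key_def by (simp add: R_def)
    then show "u = v" using K uv(1,2) unfolding good_def by (blast dest: inj_onD)
  qed
  have inj1: "inj_on (\<lambda>v. (end_of R2 v, start_of R1 v, end_of R1 v)) K"
  proof (rule inj_onI)
    fix u v
    assume uv: "u \<in> K" "v \<in> K" "(end_of R2 u, start_of R1 u, end_of R1 u) = (end_of R2 v, start_of R1 v, end_of R1 v)"
    then have "key 1 u = key 1 v" unfolding key_def by (simp add: R_def)
    then show "u = v" using K uv(1,2) unfolding good_def by (blast dest: inj_onD)
  qed
  note kernel = encodes_kernel[OF G R1 R2 KV dom inj0 inj1]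
  show "\<exists>V' E1' E2' k' ys t. computes kernelize (com_degree kernelize) xs t ys \<and>
      real t \<le> real (time_coeff kernelize * (card V + 1)) \<and> encodes_instance ys V' E1' E2' k' \<and>
      (union_is_yes V' E1' E2' k' \<longleftrightarrow> union_is_yes V E1 E2 k) \<and>
      k' \<le> id k \<and> c_all V' E1' E2' \<le> id (c_all V E1 E2) \<and>
      card V' \<le> (c_all V E1 E2) ^ 3 \<and>
      (proper_interval_graph V E1 \<or> proper_interval_graph V E2 \<longrightarrow>
         card V' \<le> 2 * (c_all V E1 E2)\<^sup>2)"
    \<comment> \<open>\<open>k\<close> is unchanged and \<open>c_all\<close> does not grow, so the
      identity serves as both parameter bounds.\<close>
    by (rule exI[of _ K], rule exI[of _ "induced K E1"], rule exI[of _ "induced K E2"], rule exI[of _ k],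
        rule exI[of _ ?ys], rule exI[of _ t], intro conjI impI)
      (use comp t kernel in \<open>simp_all del: of_nat_mult of_nat_add\<close>)
qed

end
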